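(* Assume that the following (conjectural) formula holds: for all $n_1,n_2\ge1$, all star-shaped domains $X_1\subset\mathbb{R}^{2n_1}$, $X_2\subset\mathbb{R}^{2n_2}$, all $p\ge1$ and all integers $k\ge1$, $$ c^k_{\rm EH}(X_1\times_pX_2)=\begin{cases}\min\limits_{i+j=k}\Big[c^i_{\rm EH}(X_1)^{\frac{p}{p-2}}+c^j_{\rm EH}(X_2)^{\frac{p}{p-2}}\Big]^{\frac{p-2}{p}}, & p\ge2,\\ \max\limits_{\substack{i+j=k+1\\ i,j\neq0}}\Big[c^i_{\rm EH}(X_1)^{\frac{p}{p-2}}+c^j_{\rm EH}(X_2)^{\frac{p}{p-2}}\Big]^{\frac{p-2}{p}}, & 1\le p\le2,\end{cases} $$ where $i,j$ are non-negative integers, $c^0_{\rm EH}=0$, and for $p=2$ the bracketed expressions are read as $\max\{c^i_{\rm EH}(X_1),c^j_{\rm EH}(X_2)\}$ in the first line and $\min\{c^i_{\rm EH}(X_1),c^j_{\rm EH}(X_2)\}$ in the second (for $p=\infty$ the exponents are read as $1$). Let $1\le p\le\infty$ and let $K_1,\dots,K_m\subset\mathbb{R}^{2n}$ be convex domains containing the origin such that the limits $c_\infty(K_1),\dots,c_\infty(K_m)$ exist. Then $$ c_\infty(K_1\times_p\cdots\times_pK_m)=\Big(c_\infty(K_1)^{-\frac p2}+\cdots+c_\infty(K_m)^{-\frac p2}\Big)^{-\frac2p}, $$ where for $p=\infty$ the right-hand side is read as $\min_i c_\infty(K_i)$.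
   Context: Convex domains are convex bodies (compact, convex, non-empty interior). Star-shaped domains are compact and star-shaped about the origin. $\mathbb{R}^{2n}$ carries the standard symplectic structure, and products carry the product structure. $p$-product: for $1\le p<\infty$, $K\times_p T=\bigcup_{0\le t\le1}\big((1-t)^{1/p}K\times t^{1/p}T\big)$, and $K\times_\infty T=K\times T$. The operation is associative (gauge functions satisfy $\|(x,y)\|_{K\times_pT}^p=\|x\|_K^p+\|y\|_T^p$, with the maximum for $p=\infty$). Asymptotic capacity: $c_\infty(K)=\lim_{k\to\infty}\frac{c^k_{\rm EH}(K)}{k}$. Ekeland–Hofer capacities $c^k_{\rm EH}$, $k\ge1$, of a bounded set $B\subset\mathbb{R}^{2n}$: let $E=H^{1/2}(\mathbb{R}/\mathbb{Z},\mathbb{R}^{2n})=E^-\oplus E^0\oplus E^+$ be the splitting into negative, zero and positive eigenspaces of the action functional $A(z)=\frac12\int_0^1\langle-J\dot z,z\rangle dt$, with projections $P^\pm,P^0$; $S^1$ acts by time shift, and $S^+$ is the unit sphere of $E^+$. Let $\Gamma$ be the group of homeomorphisms $h(x)=e^{\gamma^+(x)}P^+x+P^0x+e^{\gamma^-(x)}P^-x+C(x)$ of $E$, where $\gamma^\pm:E\to\mathbb{R}$ are continuous, $S^1$-invariant and bounded on bounded sets, $C:E\to E$ is continuous, $S^1$-equivariant and maps bounded sets to precompact sets, and there is $c>0$ such that $\gamma^\pm(x)=0$ and $C(x)=0$ whenever $A(x)\le0$ or $\|P^+x\|\ge c$. For an $S^1$-space $Y$, the Fadell–Rabinowitz index $\alpha(Y)$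 is the supremum of $l\ge1$ with $f^*(\eta^{l-1})\ne0$, where $f:(Y\times ES^1)/S^1\to\mathbb{CP}^\infty$ is the classifying map and $\eta$ generates $H^2(\mathbb{CP}^\infty;\mathbb{Q})$; $\alpha(\emptyset)=0$. For $S^1$-invariant $\xi\subset E$ put $\mathrm{ind}(\xi)=\min_{h\in\Gamma}\alpha(h(\xi)\cap S^+)$. Let $\mathcal{H}(B)$ be the set of smooth $H:\mathbb{R}^{2n}\to[0,\infty)$ vanishing on a neighborhood (with non-empty interior) of $\overline B$ and equal to $a|z|^2$ for $|z|$ large, for some $a>\pi$ with $a\notin\pi\mathbb{N}$. Put $c_k(H)=\inf\{\sup_{z\in\xi}(A(z)-\int_0^1H(z(t))dt):\ \xi\subset E\ S^1\text{-invariant},\ \mathrm{ind}(\xi)\ge k\}$ and $c^k_{\rm EH}(B)=\inf_{H\in\mathcal{H}(B)}c_k(H)$. *)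

theory Defs
  imports "HOL-Analysis.Analysis" "HOL-Homology.Homology"
begin

section \<open>The symplectic vector space and domains\<close>

text \<open>
  Since dimensions are quantified inside the statement, R^{2n} is the topological space
  \<^term>\<open>Euclidean_space (2 * n)\<close> of sequences vanishing from index 2n on. Coordinates are
  interleaved as (x_1, y_1, ..., x_n, y_n), so that concatenation of points realises
  R^{2a} x R^{2b} = R^{2(a+b)} with the product symplectic structure, and the standard complex
  structure J (x, y) = (-y, x) does not depend on n.
\<close>

abbreviation R2 :: "nat \<Rightarrow> (nat \<Rightarrow> real) set" where
  "R2 n \<equiv> topspace (Euclidean_space (2 * n))"

definition inner2 :: "nat \<Rightarrow> (nat \<Rightarrow> real) \<Rightarrow> (nat \<Rightarrow> real) \<Rightarrow> real" where
  "inner2 n v w = (\<Sum>i<2 * n. v i * w i)"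

abbreviation sqnorm :: "nat \<Rightarrow> (nat \<Rightarrow> real) \<Rightarrow> real" where
  "sqnorm n v \<equiv> inner2 n v v"

definition J :: "(nat \<Rightarrow> real) \<Rightarrow> nat \<Rightarrow> real" where
  "J v = (\<lambda>i. if even i then - v (i + 1) else v (i - 1))"

text \<open>The rotation e^{tJ}.\<close>

definition rot :: "real \<Rightarrow> (nat \<Rightarrow> real) \<Rightarrow> nat \<Rightarrow> real" where
  "rot t v = (\<lambda>i. cos t * v i + sin t * J v i)"

definition star_shaped_domain :: "nat \<Rightarrow> (nat \<Rightarrow> real) set \<Rightarrow> bool" where
  "star_shaped_domain n X \<longleftrightarrow>
     compactin (Euclidean_space (2 * n)) X \<and> (\<lambda>_. 0) \<in> X \<and>
     (\<forall>x\<in>X. \<forall>t\<in>{0..1}. (\<lambda>i. t * x i) \<in> X)"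

definition convex_domain :: "nat \<Rightarrow> (nat \<Rightarrow> real) set \<Rightarrow> bool" where
  "convex_domain n K \<longleftrightarrow>
     compactin (Euclidean_space (2 * n)) K \<and>
     (\<forall>x\<in>K. \<forall>y\<in>K. \<forall>t\<in>{0..1}. (\<lambda>i. (1 - t) * x i + t * y i) \<in> K) \<and>
     Euclidean_space (2 * n) interior_of K \<noteq> {}"

definition append_point :: "nat \<Rightarrow> (nat \<Rightarrow> real) \<Rightarrow> (nat \<Rightarrow> real) \<Rightarrow> nat \<Rightarrow> real" where
  "append_point d x y = (\<lambda>i. if i < d then x i else y (i - d))"

text \<open>The p-product of K in R^{2a} and T; the parameter p ranges over [1, \<infinity>].\<close>

definition p_product :: "ereal \<Rightarrow> nat \<Rightarrow> (nat \<Rightarrow> real) set \<Rightarrow> (nat \<Rightarrow> real) set \<Rightarrow> (nat \<Rightarrow> real) set"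
  where
  "p_product p a K T =
     (if p = \<infinity> then {append_point (2 * a) x y | x y. x \<in> K \<and> y \<in> T}
      else \<Union>t\<in>{0..1}. {append_point (2 * a)
                         (\<lambda>i. (1 - t) powr (1 / real_of_ereal p) * x i)
                         (\<lambda>i. t powr (1 / real_of_ereal p) * y i) | x y. x \<in> K \<and> y \<in> T})"

text \<open>
  The iterated product of a nonempty list of subsets of R^{2n}, bracketed to the right (the
  p-product is associative).
\<close>

fun p_product_list :: "ereal \<Rightarrow> nat \<Rightarrow> (nat \<Rightarrow> real) set list \<Rightarrow> (nat \<Rightarrow> real) set" where
  "p_product_list p n [] = {}"
| "p_product_list p n [K] = K"
| "p_product_list p n (K # L # Ks) = p_product p n K (p_product_list p n (L # Ks))"


section \<open>The loop space H^{1/2}(R/Z, R^{2n}) and the action functional\<close>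

definition L2_loop :: "nat \<Rightarrow> (real \<Rightarrow> nat \<Rightarrow> real) \<Rightarrow> bool" where
  "L2_loop n u \<longleftrightarrow>
     (\<forall>t. u t \<in> R2 n) \<and> (\<forall>t. u (t + 1) = u t) \<and>
     (\<forall>i. (\<lambda>t. u t i) \<in> borel_measurable lborel) \<and>
     (\<forall>i. set_integrable lborel {0..1} (\<lambda>t. (u t i)\<^sup>2))"

text \<open>
  The Fourier coefficients z_k of the expansion z(t) = sum over k of e^{2 pi k t J} z_k.
\<close>

definition fourier :: "(real \<Rightarrow> nat \<Rightarrow> real) \<Rightarrow> int \<Rightarrow> nat \<Rightarrow> real" where
  "fourier u = (\<lambda>k i. LINT t:{0..1}|lborel. rot (- 2 * pi * of_int k * t) (u t) i)"

text \<open>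
  An element of H^{1/2}, that is, a square integrable loop modulo equality almost everywhere, is
  represented by its family of Fourier coefficients. The norm is
  |z_0|^2 + 2 pi (sum over k of |k| |z_k|^2), under the square root.
\<close>

type_synonym loop = "int \<Rightarrow> nat \<Rightarrow> real"

definition E :: "nat \<Rightarrow> loop set" where
  "E n = {fourier u | u. L2_loop n u \<and>
            (\<lambda>k. \<bar>of_int k\<bar> * sqnorm n (fourier u k)) summable_on UNIV}"

definition E_norm :: "nat \<Rightarrow> loop \<Rightarrow> real" where
  "E_norm n x = sqrt (sqnorm n (x 0) + 2 * pi * (\<Sum>\<^sub>\<infinity>k. \<bar>of_int k\<bar> * sqnorm n (x k)))"

definition E_top :: "nat \<Rightarrow> loop topology" where
  "E_top n = Metric_space.mtopology (E n) (\<lambda>x y. E_norm n (\<lambda>k i. x k i - y k i))"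

definition P_plus :: "loop \<Rightarrow> loop" where
  "P_plus x = (\<lambda>k. if k > 0 then x k else (\<lambda>_. 0))"

definition P_zero :: "loop \<Rightarrow> loop" where
  "P_zero x = (\<lambda>k. if k = 0 then x k else (\<lambda>_. 0))"

definition P_minus :: "loop \<Rightarrow> loop" where
  "P_minus x = (\<lambda>k. if k < 0 then x k else (\<lambda>_. 0))"

definition S_plus :: "nat \<Rightarrow> loop set" where
  "S_plus n = {x \<in> E n. P_plus x = x \<and> E_norm n x = 1}"

text \<open>
  Time shift z(t) to z(t + s). The circle R/Z acts through the parameter s in R.
\<close>

definition shift :: "real \<Rightarrow> loop \<Rightarrow> loop" where
  "shift s x = (\<lambda>k. rot (2 * pi * of_int k * s) (x k))"

definition shift_invariant :: "loop set \<Rightarrow> bool" where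
  "shift_invariant Y \<longleftrightarrow> (\<forall>s. \<forall>x\<in>Y. shift s x \<in> Y)"

text \<open>
  The action functional (1/2) int_0^1 <-J z', z> dt on H^{1/2}, where the integral is the continuous
  extension from smooth loops. The lemma \<open>action_trigonometric\<close> below identifies it with the
  integral on trigonometric polynomials, which are dense.
\<close>

definition action :: "nat \<Rightarrow> loop \<Rightarrow> real" where
  "action n x = pi * (\<Sum>\<^sub>\<infinity>k. of_int k * sqnorm n (x k))"

lemma inner2_rot:
  "inner2 n (rot a v) (rot b w) = cos (a - b) * inner2 n v w + sin (a - b) * inner2 n (J v) w"
proof (induction n)
  case 0
  then show ?case by (simp add: inner2_def)
next
  case (Suc n)
  have *: "inner2 (Suc n) v w = inner2 n v w + (v (2*n) * w (2*n) + v (Suc (2*n)) * w (Suc (2*n)))"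
    for v w by (simp add: inner2_def)
  show ?case
    unfolding * Suc.IH
    by (simp add: rot_def J_def cos_diff sin_diff algebra_simps)
qed

lemma integral_cos_sin_period:
  fixes m :: int
  shows "((\<lambda>t. cos (2 * pi * of_int m * t) * c + sin (2 * pi * of_int m * t) * d)
           has_integral (if m = 0 then c else 0)) {0..1::real}"
proof (cases "m = 0")
  case True
  then show ?thesis using has_integral_const_real[of c 0 1] by simp
next
  case False
  let ?w = "2 * pi * of_int m :: real"
  have w: "?w \<noteq> 0" using False by simp
  have "((\<lambda>t. cos (?w * t) * c + sin (?w * t) * d) has_integral
      ((sin (?w * 1) * c - cos (?w * 1) * d) / ?w - (sin (?w * 0) * c - cos (?w * 0) * d) / ?w)) {0..1}"
  proof (rule fundamental_theorem_of_calculus)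
    fix x :: real
    have "((\<lambda>t. (sin (?w * t) * c - cos (?w * t) * d) / ?w) has_real_derivative
       (cos (?w * x) * c + sin (?w * x) * d)) (at x within {0..1})"
      using w by (auto intro!: derivative_eq_intros simp: field_simps)
    then show "((\<lambda>t. (sin (?w * t) * c - cos (?w * t) * d) / ?w) has_vector_derivative
       (cos (?w * x) * c + sin (?w * x) * d)) (at x within {0..1})"
      by (simp add: has_real_derivative_iff_has_vector_derivative)
  qed simp
  moreover have "sin ?w = 0" "cos ?w = 1"
    using sin_int_2pin[of m] cos_int_2pin[of m] by (simp_all add: mult_ac)
  ultimately show ?thesis using False by simp
qed

lemma action_trigonometric:
  fixes x :: loop and F :: "int set"
  assumes F: "finite F"
  defines "z \<equiv> \<lambda>t i. \<Sum>k\<in>F. rot (2 * pi * of_int k * t) (x k) i"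
    and "z' \<equiv> \<lambda>t i. \<Sum>k\<in>F. 2 * pi * of_int k * J (rot (2 * pi * of_int k * t) (x k)) i"
  shows "((\<lambda>s. z s i) has_real_derivative z' t i) (at t)"
    and "((\<lambda>t. inner2 n (\<lambda>i. - J (z' t) i) (z t)) has_integral
            2 * action n (\<lambda>k. if k \<in> F then x k else (\<lambda>_. 0))) {0..1}"
proof -
  show "((\<lambda>s. z s i) has_real_derivative z' t i) (at t)"
    unfolding z_def z'_def
    by (rule DERIV_sum)
       (auto simp: rot_def J_def algebra_simps intro!: derivative_eq_intros)
  have mJ: "(\<lambda>i. - J (z' t) i)
      = (\<lambda>i. \<Sum>k\<in>F. 2 * pi * of_int k * rot (2 * pi * of_int k * t) (x k) i)" for t
    by (rule ext) (auto simp: z'_def J_def sum_negf[symmetric] intro!: sum.cong)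
  have eq: "inner2 n (\<lambda>i. - J (z' t) i) (z t) =
     (\<Sum>k\<in>F. \<Sum>l\<in>F. cos (2 * pi * of_int (k - l) * t) * (2 * pi * of_int k * inner2 n (x k) (x l))
         + sin (2 * pi * of_int (k - l) * t) * (2 * pi * of_int k * inner2 n (J (x k)) (x l)))" for t
  proof -
    have "inner2 n (\<lambda>i. - J (z' t) i) (z t) = (\<Sum>k\<in>F. \<Sum>l\<in>F. 2 * pi * of_int k *
       inner2 n (rot (2 * pi * of_int k * t) (x k)) (rot (2 * pi * of_int l * t) (x l)))"
    proof -
      let ?a = "\<lambda>k i. 2 * pi * of_int k * rot (2 * pi * of_int k * t) (x k) i"
      let ?b = "\<lambda>l i. rot (2 * pi * of_int l * t) (x l) i"
      have "inner2 n (\<lambda>i. - J (z' t) i) (z t) = (\<Sum>i<2*n. \<Sum>k\<in>F. \<Sum>l\<in>F. ?a k i * ?b l i)"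
        unfolding mJ z_def inner2_def by (simp only: sum_product)
      also have "\<dots> = (\<Sum>k\<in>F. \<Sum>i<2*n. \<Sum>l\<in>F. ?a k i * ?b l i)"
        by (rule sum.swap)
      also have "\<dots> = (\<Sum>k\<in>F. \<Sum>l\<in>F. \<Sum>i<2*n. ?a k i * ?b l i)"
        by (rule sum.cong[OF refl], rule sum.swap)
      finally show ?thesis
        by (simp only: inner2_def sum_distrib_left mult.assoc)
    qed
    then show ?thesis
      unfolding inner2_rot by (simp add: algebra_simps)
  qed
  have "((\<lambda>t. inner2 n (\<lambda>i. - J (z' t) i) (z t)) has_integral
     (\<Sum>k\<in>F. \<Sum>l\<in>F. if k - l = 0 then 2 * pi * of_int k * inner2 n (x k) (x l) else 0)) {0..1}"
    unfolding eq by (intro has_integral_sum F integral_cos_sin_period)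
  moreover have "(\<Sum>\<^sub>\<infinity>k. of_int k * sqnorm n (if k \<in> F then x k else (\<lambda>_. 0)))
      = (\<Sum>k\<in>F. of_int k * sqnorm n (x k))"
    using F by (subst infsum_cong_neutral[where T = F and g = "\<lambda>k. of_int k * sqnorm n (x k)"])
               (auto simp: inner2_def)
  ultimately show "((\<lambda>t. inner2 n (\<lambda>i. - J (z' t) i) (z t)) has_integral
            2 * action n (\<lambda>k. if k \<in> F then x k else (\<lambda>_. 0))) {0..1}"
    using F by (simp add: action_def sum_distrib_left mult_ac)
qed


section \<open>The group Gamma of admissible homeomorphisms\<close>

definition Gamma :: "nat \<Rightarrow> (loop \<Rightarrow> loop) set" where
  "Gamma n = {h. homeomorphic_map (E_top n) (E_top n) h \<and>
     (\<exists>gp gm C.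
        (\<forall>x\<in>E n. h x = (\<lambda>k i. exp (gp x) * P_plus x k i + P_zero x k i
                                 + exp (gm x) * P_minus x k i + C x k i)) \<and>
        (\<forall>g\<in>{gp, gm}. continuous_map (E_top n) euclideanreal g \<and>
            (\<forall>s. \<forall>x\<in>E n. g (shift s x) = g x) \<and>
            (\<forall>r. \<exists>M. \<forall>x\<in>E n. E_norm n x \<le> r \<longrightarrow> \<bar>g x\<bar> \<le> M)) \<and>
        continuous_map (E_top n) (E_top n) C \<and>
        (\<forall>s. \<forall>x\<in>E n. C (shift s x) = shift s (C x)) \<and>
        (\<forall>r. \<exists>Q. compactin (E_top n) Q \<and> C ` {x \<in> E n. E_norm n x \<le> r} \<subseteq> Q) \<and>
        (\<exists>c>0. \<forall>x\<in>E n. action n x \<le> 0 \<or> E_norm n (P_plus x) \<ge> c \<longrightarrow>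
            gp x = 0 \<and> gm x = 0 \<and> C x = (\<lambda>_ _. 0)))}"


section \<open>Singular cohomology with rational coefficients\<close>

text \<open>
  A p-cochain on X is a rational function of singular p-simplices; only its values on singular
  simplices of X matter.
\<close>

type_synonym 'a cochain = "((nat \<Rightarrow> real) \<Rightarrow> 'a) \<Rightarrow> rat"

definition coboundary :: "nat \<Rightarrow> 'a cochain \<Rightarrow> 'a cochain" where
  "coboundary p f = (\<lambda>\<sigma>. \<Sum>i\<le>Suc p. (- 1) ^ i * f (singular_face (Suc p) i \<sigma>))"

definition cocycle :: "'a topology \<Rightarrow> nat \<Rightarrow> 'a cochain \<Rightarrow> bool" where
  "cocycle X p f \<longleftrightarrow> (\<forall>\<sigma>. singular_simplex (Suc p) X \<sigma> \<longrightarrow> coboundary p f \<sigma> = 0)"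

definition zero_in_cohomology :: "'a topology \<Rightarrow> nat \<Rightarrow> 'a cochain \<Rightarrow> bool" where
  "zero_in_cohomology X p f \<longleftrightarrow>
     (case p of
        0 \<Rightarrow> \<forall>\<sigma>. singular_simplex 0 X \<sigma> \<longrightarrow> f \<sigma> = 0
      | Suc q \<Rightarrow> \<exists>g. \<forall>\<sigma>. singular_simplex (Suc q) X \<sigma> \<longrightarrow> f \<sigma> = coboundary q g \<sigma>)"

text \<open>
  The cup product evaluates f on the front p-face and g on the back q-face of a (p+q)-simplex.
\<close>

definition cup :: "nat \<Rightarrow> nat \<Rightarrow> 'a cochain \<Rightarrow> 'a cochain \<Rightarrow> 'a cochain" where
  "cup p q f g = (\<lambda>\<sigma>. f (restrict \<sigma> (standard_simplex p))
                     * g (restrict (\<lambda>x. \<sigma> (\<lambda>i. if i < p then 0 else x (i - p))) (standard_simplex q)))"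

primrec cup_power :: "nat \<Rightarrow> 'a cochain \<Rightarrow> nat \<Rightarrow> 'a cochain" where
  "cup_power p f 0 = (\<lambda>_. 1)"
| "cup_power p f (Suc m) = cup p (p * m) f (cup_power p f m)"

definition pullback_cochain :: "nat \<Rightarrow> ('a \<Rightarrow> 'b) \<Rightarrow> 'b cochain \<Rightarrow> 'a cochain" where
  "pullback_cochain p F f = (\<lambda>\<sigma>. f (simplex_map p F \<sigma>))"

definition generates_cohomology :: "'a topology \<Rightarrow> nat \<Rightarrow> 'a cochain \<Rightarrow> bool" where
  "generates_cohomology X p f \<longleftrightarrow>
     cocycle X p f \<and>
     (\<forall>g. cocycle X p g \<longrightarrow> (\<exists>r. zero_in_cohomology X p (\<lambda>\<sigma>. g \<sigma> - r * f \<sigma>)))"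


section \<open>The Fadell--Rabinowitz index\<close>

definition quotient_topology :: "'a topology \<Rightarrow> ('a \<Rightarrow> 'b) \<Rightarrow> 'b topology" where
  "quotient_topology X q =
     topology (\<lambda>U. U \<subseteq> q ` topspace X \<and> openin X {x \<in> topspace X. q x \<in> U})"

lemma openin_quotient_topology:
  "openin (quotient_topology X q) U \<longleftrightarrow>
     U \<subseteq> q ` topspace X \<and> openin X {x \<in> topspace X. q x \<in> U}"
proof -
  have "istopology (\<lambda>U. U \<subseteq> q ` topspace X \<and> openin X {x \<in> topspace X. q x \<in> U})"
    unfolding istopology_def
  proof (intro conjI allI impI, goal_cases)
    case (2 S T)
    then have "openin X ({x \<in> topspace X. q x \<in> S} \<inter> {x \<in> topspace X. q x \<in> T})" by blast
    moreover have "{x \<in> topspace X. q x \<in> S \<inter> T}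
        = {x \<in> topspace X. q x \<in> S} \<inter> {x \<in> topspace X. q x \<in> T}" by blast
    ultimately show ?case by simp
  next
    case (4 \<K>)
    then have "openin X (\<Union>K\<in>\<K>. {x \<in> topspace X. q x \<in> K})" by blast
    moreover have "{x \<in> topspace X. q x \<in> \<Union>\<K>} = (\<Union>K\<in>\<K>. {x \<in> topspace X. q x \<in> K})" by blast
    ultimately show ?case by simp
  qed blast+
  then show ?thesis
    unfolding quotient_topology_def by (simp add: topology_inverse')
qed

text \<open>
  The model of the contractible free circle space ES^1: the infinite sphere, that is, the union of
  the spheres S^N with the direct limit topology. The circle acts by \<^const>\<open>rot\<close>.
\<close>

definition ES1 :: "(nat \<Rightarrow> real) topology" where
  "ES1 = topology (\<lambda>U. U \<subseteq> (\<Union>N. topspace (nsphere N)) \<and>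
                       (\<forall>N. openin (nsphere N) (topspace (nsphere N) \<inter> U)))"

lemma openin_ES1:
  "openin ES1 U \<longleftrightarrow> U \<subseteq> (\<Union>N. topspace (nsphere N)) \<and>
                    (\<forall>N. openin (nsphere N) (topspace (nsphere N) \<inter> U))"
proof -
  have "istopology (\<lambda>U. U \<subseteq> (\<Union>N. topspace (nsphere N)) \<and>
                       (\<forall>N. openin (nsphere N) (topspace (nsphere N) \<inter> U)))"
    unfolding istopology_def
  proof (intro conjI allI impI, goal_cases)
    case (2 S T N)
    then have "openin (nsphere N) ((topspace (nsphere N) \<inter> S) \<inter> (topspace (nsphere N) \<inter> T))" by blast
    then show ?case by (simp add: Int_ac)
  next
    case (4 \<K> N)
    then have "openin (nsphere N) (\<Union>K\<in>\<K>. topspace (nsphere N) \<inter> K)" by blast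
    then show ?case by (simp only: Int_Union)
  qed blast+
  then show ?thesis
    unfolding ES1_def by (simp add: topology_inverse')
qed

definition circle_orbit :: "(nat \<Rightarrow> real) \<Rightarrow> (nat \<Rightarrow> real) set" where
  "circle_orbit v = {rot (2 * pi * s) v | s. True}"

definition CP_infinity :: "(nat \<Rightarrow> real) set topology" where
  "CP_infinity = quotient_topology ES1 circle_orbit"

definition diagonal_orbit :: "loop \<times> (nat \<Rightarrow> real) \<Rightarrow> (loop \<times> (nat \<Rightarrow> real)) set" where
  "diagonal_orbit = (\<lambda>(x, v). {(shift s x, rot (2 * pi * s) v) | s. True})"

text \<open>The Borel construction (Y x ES^1)/S^1 of an invariant set Y of loops in R^{2n}.\<close>

definition borel_space :: "nat \<Rightarrow> loop set \<Rightarrow> (loop \<times> (nat \<Rightarrow> real)) set topology" where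
  "borel_space n Y = quotient_topology (prod_topology (subtopology (E_top n) Y) ES1) diagonal_orbit"

text \<open>
  The classifying map of the circle bundle Y x ES^1 over the Borel construction is induced by the
  projection to ES^1, that is, it maps the orbit of (x, v) to the orbit of v.
\<close>

definition classifying_map :: "(loop \<times> (nat \<Rightarrow> real)) set \<Rightarrow> (nat \<Rightarrow> real) set" where
  "classifying_map = image snd"

definition FR_index :: "nat \<Rightarrow> loop set \<Rightarrow> enat" where
  "FR_index n Y = Sup {enat l | l. 1 \<le> l \<and>
     (\<exists>\<eta>. generates_cohomology CP_infinity 2 \<eta> \<and>
        \<not> zero_in_cohomology (borel_space n Y) (2 * (l - 1))
            (pullback_cochain (2 * (l - 1)) classifying_map (cup_power 2 \<eta> (l - 1))))}"

definition ind :: "nat \<Rightarrow> loop set \<Rightarrow> enat" where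
  "ind n \<xi> = (INF h\<in>Gamma n. FR_index n (h ` \<xi> \<inter> S_plus n))"


section \<open>Ekeland--Hofer capacities\<close>

primrec C_differentiable :: "nat \<Rightarrow> nat \<Rightarrow> ((nat \<Rightarrow> real) \<Rightarrow> real) \<Rightarrow> bool" where
  "C_differentiable n 0 f \<longleftrightarrow> continuous_map (Euclidean_space (2 * n)) euclideanreal f"
| "C_differentiable n (Suc m) f \<longleftrightarrow>
     continuous_map (Euclidean_space (2 * n)) euclideanreal f \<and>
     (\<exists>g. \<forall>i<2 * n. C_differentiable n m (g i) \<and>
        (\<forall>z\<in>R2 n. ((\<lambda>s. f (z(i := s))) has_real_derivative g i z) (at (z i))))"

definition smooth :: "nat \<Rightarrow> ((nat \<Rightarrow> real) \<Rightarrow> real) \<Rightarrow> bool" where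
  "smooth n f \<longleftrightarrow> (\<forall>m. C_differentiable n m f)"

definition Hamiltonians :: "nat \<Rightarrow> (nat \<Rightarrow> real) set \<Rightarrow> ((nat \<Rightarrow> real) \<Rightarrow> real) set" where
  "Hamiltonians n B = {H. smooth n H \<and> (\<forall>z\<in>R2 n. 0 \<le> H z) \<and>
     (\<exists>U. openin (Euclidean_space (2 * n)) U \<and> U \<noteq> {} \<and>
          Euclidean_space (2 * n) closure_of B \<subseteq> U \<and> (\<forall>z\<in>U. H z = 0)) \<and>
     (\<exists>a. a > pi \<and> (\<forall>j::nat. a \<noteq> pi * real j) \<and>
          (\<exists>r. \<forall>z\<in>R2 n. sqnorm n z \<ge> r \<longrightarrow> H z = a * sqnorm n z))}"

text \<open>
  The integral of H along an element of H^{1/2}; it does not depend on the chosen representative,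
  as any two of them agree almost everywhere.
\<close>

definition H_integral :: "((nat \<Rightarrow> real) \<Rightarrow> real) \<Rightarrow> nat \<Rightarrow> loop \<Rightarrow> real" where
  "H_integral H n x = (LINT t:{0..1}|lborel. H ((SOME u. L2_loop n u \<and> fourier u = x) t))"

definition minimax :: "nat \<Rightarrow> nat \<Rightarrow> ((nat \<Rightarrow> real) \<Rightarrow> real) \<Rightarrow> ereal" where
  "minimax n k H = Inf {(SUP z\<in>\<xi>. ereal (action n z - H_integral H n z)) | \<xi>.
                          \<xi> \<subseteq> E n \<and> shift_invariant \<xi> \<and> ind n \<xi> \<ge> enat k}"

definition c_EH :: "nat \<Rightarrow> nat \<Rightarrow> (nat \<Rightarrow> real) set \<Rightarrow> ereal" where
  "c_EH n k B = (if k = 0 then 0 else INF H\<in>Hamiltonians n B. minimax n k H)"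

definition c_infinity_exists :: "nat \<Rightarrow> (nat \<Rightarrow> real) set \<Rightarrow> bool" where
  "c_infinity_exists n K \<longleftrightarrow> (\<exists>L::real. (\<lambda>k. c_EH n k K / ereal (real k)) \<longlonglongrightarrow> ereal L)"

definition c_infinity :: "nat \<Rightarrow> (nat \<Rightarrow> real) set \<Rightarrow> ereal" where
  "c_infinity n K = lim (\<lambda>k. c_EH n k K / ereal (real k))"


section \<open>The product formula\<close>

text \<open>
  Powers of elements of [0, \<infinity>] with the usual conventions 0^r = \<infinity>, \<infinity>^r = 0 for r < 0
  and 0^r = 0, \<infinity>^r = \<infinity> for r > 0. Negative bases, which do not occur, are treated as 0.
\<close>

definition epowr :: "ereal \<Rightarrow> real \<Rightarrow> ereal" where
  "epowr x r =
     (if r = 0 then 1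
      else if x \<le> 0 then (if r > 0 then 0 else \<infinity>)
      else if x = \<infinity> then (if r > 0 then \<infinity> else 0)
      else ereal (real_of_ereal x powr r))"

text \<open>The bracket [a^{p/(p-2)} + b^{p/(p-2)}]^{(p-2)/p} for p different from 2.\<close>

definition bracket :: "ereal \<Rightarrow> ereal \<Rightarrow> ereal \<Rightarrow> ereal" where
  "bracket p a b =
     (if p = \<infinity> then a + b
      else let r = real_of_ereal p
           in epowr (epowr a (r / (r - 2)) + epowr b (r / (r - 2))) ((r - 2) / r))"

end

theory Submission
  imports Defs
begin

text \<open>
  The product formula reduces the theorem to real sequences. Write \<open>a\<close> and \<open>b\<close> for the
  capacities of the two factors, so that \<open>a i\<close> is about \<open>L * i\<close> and \<open>b j\<close> is about \<open>M * j\<close>. The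
  capacity of index \<open>k\<close> of the product is the best value, over the splittings of \<open>k\<close> (of
  \<open>k + 1\<close> if p < 2) as \<open>i + j\<close>, of \<open>g (a i) (b j)\<close>, where \<open>g\<close> is homogeneous of degree one. After
  division by \<open>k\<close> it should converge to the optimum of \<open>g (x * L) ((1 - x) * M)\<close> over x in [0, 1].
  For p other than 2 and \<infinity>, put s = p / (p - 2), A = L^(-p/2) and B = M^(-p/2). Radon's inequality
    (A + B)^(1-s) (X + Y)^s \<le> A^(1-s) X^s + B^(1-s) Y^s
  bounds \<open>g\<close> by a linear function that touches it at x = A / (A + B), and the value of this optimum
  is (A + B)^(-2/p), which is the claimed limit. The inequality between the brackets is reversed for
  p < 2, where the outer exponent 1/s is negative and the minimum becomes a maximum; for p = 2 and
  p = \<infinity> the linear bound is elementary.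

  A linear bound makes the convergence robust (\<open>optimal_split_limit\<close>): on every splitting the
  error terms of \<open>a i\<close> and \<open>b j\<close> are o(k), uniformly in the splitting, so the bound is
  N * k + o(k), and a splitting with i / k tending to the point of contact reaches N * k + o(k).
  If L or M vanishes, A or B is infinite, but the product capacity is then squeezed between 0 and
  a single capacity of the degenerate factor (\<open>optimal_split_limit_0\<close>), which agrees with the
  conventions on powers of 0 and \<infinity>.

  The reduction needs capacities that are finite and nonnegative. Monotonicity in k is immediate from
  the minimax definition, and it gives finiteness once the limit exists. Nonnegativity follows from the
  product formula itself: for p = 2 both of its lines apply, and for k = 1 and two equal factors they say
  that max 0 c = c for the first capacity c. Finally, products of star-shaped domains are star-shaped,
  so the case of two factors can be iterated.
\<close>

section \<open>Optimal splittings of asymptotically linear sequences\<close>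

text \<open>
  The indices \<open>i k\<close> may be small for large \<open>k\<close>, so the hypothesis on \<open>e\<close> cannot be used along
  them directly; the bound \<open>\<bar>e m\<bar> \<le> C + \<epsilon> * m\<close>, valid for all \<open>m\<close>, is what survives the substitution.
\<close>

lemma sublinear_reindex:
  fixes e :: "nat \<Rightarrow> real"
  assumes e: "(\<lambda>m. e m / real m) \<longlonglongrightarrow> 0" and i: "\<And>k. k \<ge> 1 \<Longrightarrow> i k \<le> k + d"
  shows "(\<lambda>k. e (i k) / real k) \<longlonglongrightarrow> 0"
proof (rule LIMSEQ_I)
  fix r :: real assume "0 < r"
  then obtain m0 where m0: "\<And>m. m \<ge> m0 \<Longrightarrow> \<bar>e m / real m\<bar> < r / 2"
    using LIMSEQ_D[OF e, of "r / 2"] by auto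
  define C where "C = (\<Sum>m\<le>m0. \<bar>e m\<bar>)"
  have bound: "\<bar>e m\<bar> \<le> C + r / 2 * real m" for m
  proof (cases "m \<le> m0")
    case True
    then have "\<bar>e m\<bar> \<le> C"
      unfolding C_def by (intro member_le_sum) auto
    with \<open>0 < r\<close> show ?thesis
      by (smt (verit) divide_nonneg_nonneg mult_nonneg_nonneg of_nat_0_le_iff)
  next
    case False
    then have "\<bar>e m\<bar> / real m < r / 2" "real m > 0"
      using m0[of m] by auto
    then have "\<bar>e m\<bar> \<le> r / 2 * real m"
      by (simp add: field_simps)
    moreover have "C \<ge> 0" by (simp add: C_def sum_nonneg)
    ultimately show ?thesis by simp
  qed
  obtain k0 :: nat where k0: "C + r / 2 * real d < r / 2 * real k0"
    using reals_Archimedean3[of "r / 2"] \<open>0 < r\<close> by (metis half_gt_zero mult.commute)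
  have "norm (e (i k) / real k - 0) < r" if "k \<ge> max 1 k0" for k
  proof -
    have "\<bar>e (i k)\<bar> \<le> C + r / 2 * real (i k)" by (rule bound)
    also have "\<dots> \<le> C + r / 2 * real (k + d)"
      using i[of k] that \<open>0 < r\<close> by (intro add_left_mono mult_left_mono) auto
    also have "\<dots> < r / 2 * real k0 + r / 2 * real k"
      using k0 by (subst of_nat_add, subst distrib_left) linarith
    also have "\<dots> \<le> r / 2 * real k + r / 2 * real k"
      using that \<open>0 < r\<close> by (intro add_right_mono mult_left_mono) auto
    finally have "\<bar>e (i k)\<bar> < r * real k" by simp
    with that show ?thesis by (simp add: field_simps)
  qed
  then show "\<exists>no. \<forall>n\<ge>no. norm (e (i n) / real n - 0) < r" by blast
qed

lemma linear_reindex: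
  fixes a :: "nat \<Rightarrow> real"
  assumes a: "(\<lambda>m. a m / real m) \<longlonglongrightarrow> L" and i: "\<And>k. k \<ge> 1 \<Longrightarrow> i k \<le> k + d"
  shows "(\<lambda>k. (a (i k) - L * real (i k)) / real k) \<longlonglongrightarrow> 0"
proof (rule sublinear_reindex[OF _ i])
  have "(\<lambda>m. a m / real m - L) \<longlonglongrightarrow> L - L"
    using a by (intro tendsto_intros)
  moreover have "\<forall>\<^sub>F m in sequentially. a m / real m - L = (a m - L * real m) / real m"
    using eventually_gt_at_top[of 0] by eventually_elim (simp add: field_simps)
  ultimately show "(\<lambda>m. (a m - L * real m) / real m) \<longlonglongrightarrow> 0"
    using tendsto_cong by force
qed

text \<open>
  The function \<open>u, v \<mapsto> N * (u + v)\<close> is a linear lower bound of \<open>g (L * u) (M * v)\<close>, with contact at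
  \<open>(\<theta>, 1 - \<theta>)\<close>. At a minimising splitting it bounds \<open>c k\<close> from below by N * k + o(k); the splitting of
  ratio \<open>\<theta>\<close> bounds it from above. The offset \<open>d\<close> distinguishes the splittings \<open>i + j = k\<close> from the
  splittings \<open>i + j = k + 1\<close> with positive parts. Maxima are covered by negating \<open>g\<close>, \<open>c\<close> and \<open>N\<close>,
  and therefore \<open>N\<close> may have any sign.
\<close>

lemma optimal_split_limit:
  fixes a b c :: "nat \<Rightarrow> real" and g :: "real \<Rightarrow> real \<Rightarrow> real"
  assumes a: "(\<lambda>k. a k / real k) \<longlonglongrightarrow> L" and b: "(\<lambda>k. b k / real k) \<longlonglongrightarrow> M"
    and pos: "0 < L" "0 < M" and nonneg: "\<And>k. 0 \<le> a k" "\<And>k. 0 \<le> b k"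
    and homogeneous: "\<And>t x y. 0 < t \<Longrightarrow> 0 \<le> x \<Longrightarrow> 0 \<le> y \<Longrightarrow> g (t * x) (t * y) = t * g x y"
    and tangent: "\<And>u v. 0 \<le> u \<Longrightarrow> 0 \<le> v \<Longrightarrow> N * (u + v) \<le> g (L * u) (M * v)"
    and \<theta>: "0 \<le> \<theta>" "\<theta> \<le> 1"
    and contact: "\<And>u v :: nat \<Rightarrow> real. u \<longlonglongrightarrow> \<theta> * L \<Longrightarrow> v \<longlonglongrightarrow> (1 - \<theta>) * M \<Longrightarrow>
                    (\<lambda>k. g (u k) (v k)) \<longlonglongrightarrow> N"
    and d: "d \<le> 1"
    and attained: "\<And>k. 1 \<le> k \<Longrightarrow> \<exists>i j. i + j = k + d \<and> c k = g (a i) (b j)"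
    and optimal: "\<And>k i j. 1 \<le> k \<Longrightarrow> i + j = k + d \<Longrightarrow> d \<le> i \<Longrightarrow> d \<le> j \<Longrightarrow> c k \<le> g (a i) (b j)"
  shows "(\<lambda>k. c k / real k) \<longlonglongrightarrow> N"
proof -
  obtain i j where ij: "\<And>k. 1 \<le> k \<Longrightarrow> i k + j k = k + d"
    and c: "\<And>k. 1 \<le> k \<Longrightarrow> c k = g (a (i k)) (b (j k))"
    using attained by metis
  have le: "1 \<le> k \<Longrightarrow> i k \<le> k + d" "1 \<le> k \<Longrightarrow> j k \<le> k + d" for k
    using ij[of k] by auto
  have drift: "(\<lambda>k. (real k + real d) / real k) \<longlonglongrightarrow> 1"
    by real_asymp
  have "(\<lambda>k. N * (1 / L * ((a (i k) - L * real (i k)) / real k)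
               + 1 / M * ((b (j k) - M * real (j k)) / real k) + (real k + real d) / real k))
         \<longlonglongrightarrow> N * (1 / L * 0 + 1 / M * 0 + 1)"
    by (intro tendsto_intros drift linear_reindex[OF a le(1)] linear_reindex[OF b le(2)])
  moreover have "\<forall>\<^sub>F k in sequentially.
      N * (1 / L * ((a (i k) - L * real (i k)) / real k)
         + 1 / M * ((b (j k) - M * real (j k)) / real k) + (real k + real d) / real k)
      = N * (a (i k) / L + b (j k) / M) / real k"
    using eventually_ge_at_top[of 1]
  proof eventually_elim
    case (elim k)
    have "real k + real d = real (i k) + real (j k)"
      using ij[OF elim] by linarith
    then show ?case
      using pos elim by (simp add: field_simps)
  qed
  ultimately have lower: "(\<lambda>k. N * (a (i k) / L + b (j k) / M) / real k) \<longlonglongrightarrow> N"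
    using tendsto_cong by force

  \<comment> \<open>The splitting of ratio \<open>\<theta>\<close>; rounding \<open>\<theta> * (k - d)\<close> and adding \<open>d\<close> keeps both parts at least \<open>d\<close>.\<close>
  define i' where "i' k = d + nat \<lfloor>\<theta> * real (k - d)\<rfloor>" for k
  define j' where "j' k = k + d - i' k" for k
  have floor_le: "nat \<lfloor>\<theta> * real m\<rfloor> \<le> m" for m
  proof -
    have "\<theta> * real m \<le> 1 * real m" using \<theta> by (intro mult_right_mono) auto
    then have "\<lfloor>\<theta> * real m\<rfloor> \<le> int m" by (simp add: floor_le_iff)
    then show ?thesis by simp
  qed
  have i': "d \<le> i' k" "i' k \<le> k" if "1 \<le> k" for k
    using floor_le[of "k - d"] d that by (auto simp: i'_def)
  have j': "d \<le> j' k" "i' k + j' k = k + d" "j' k \<le> k + d" if "1 \<le> k" for k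
    using i'[OF that] by (auto simp: j'_def)
  have ratio: "(\<lambda>k. real (i' k) / real k) \<longlonglongrightarrow> \<theta>"
  proof (rule tendsto_sandwich)
    show "\<forall>\<^sub>F k in sequentially. (\<theta> * real (k - d) - 1) / real k \<le> real (i' k) / real k"
      unfolding i'_def by (intro always_eventually allI divide_right_mono) linarith+
    show "\<forall>\<^sub>F k in sequentially. real (i' k) / real k \<le> (\<theta> * real k + 1) / real k"
    proof (intro always_eventually allI divide_right_mono)
      fix k
      have "real (nat \<lfloor>\<theta> * real (k - d)\<rfloor>) \<le> \<theta> * real (k - d)"
        using \<theta> by (simp add: of_nat_floor)
      also have "\<dots> \<le> \<theta> * real k"
        using \<theta> by (intro mult_left_mono) auto
      finally show "real (i' k) \<le> \<theta> * real k + 1"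
        using d by (simp add: i'_def)
    qed simp
    have "(\<lambda>k. (\<theta> * (real k - real d) - 1) / real k) \<longlonglongrightarrow> \<theta>"
      by real_asymp
    moreover have "\<forall>\<^sub>F k in sequentially.
        (\<theta> * (real k - real d) - 1) / real k = (\<theta> * real (k - d) - 1) / real k"
      using eventually_ge_at_top[of d] by eventually_elim (simp add: of_nat_diff)
    ultimately show "(\<lambda>k. (\<theta> * real (k - d) - 1) / real k) \<longlonglongrightarrow> \<theta>"
      by (rule Lim_transform_eventually)
    show "(\<lambda>k. (\<theta> * real k + 1) / real k) \<longlonglongrightarrow> \<theta>"
      by real_asymp
  qed
  have "(\<lambda>k. (a (i' k) - L * real (i' k)) / real k + L * (real (i' k) / real k)) \<longlonglongrightarrow> 0 + L * \<theta>"
    by (intro tendsto_intros ratio linear_reindex[OF a, of _ d]) (use i' in \<open>simp add: trans_le_add1\<close>)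
  then have a': "(\<lambda>k. a (i' k) / real k) \<longlonglongrightarrow> \<theta> * L"
    by (simp add: diff_divide_distrib mult.commute)
  have "(\<lambda>k. (b (j' k) - M * real (j' k)) / real k
           + M * ((real k + real d) / real k - real (i' k) / real k)) \<longlonglongrightarrow> 0 + M * (1 - \<theta>)"
    by (intro tendsto_intros ratio drift linear_reindex[OF b, of _ d] j')
  moreover have "\<forall>\<^sub>F k in sequentially. (b (j' k) - M * real (j' k)) / real k
           + M * ((real k + real d) / real k - real (i' k) / real k) = b (j' k) / real k"
    using eventually_ge_at_top[of 1]
  proof eventually_elim
    case (elim k)
    have "real k + real d = real (i' k) + real (j' k)"
      using j'(2)[OF elim] by linarith
    then show ?case
      using elim by (simp add: field_simps)
  qed
  ultimately have "(\<lambda>k. b (j' k) / real k) \<longlonglongrightarrow> 0 + M * (1 - \<theta>)"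
    by (rule Lim_transform_eventually)
  then have b': "(\<lambda>k. b (j' k) / real k) \<longlonglongrightarrow> (1 - \<theta>) * M"
    by (simp add: mult.commute)
  have upper: "(\<lambda>k. g (a (i' k) / real k) (b (j' k) / real k)) \<longlonglongrightarrow> N"
    by (rule contact[OF a' b'])

  show ?thesis
  proof (rule tendsto_sandwich[OF _ _ lower upper])
    show "\<forall>\<^sub>F k in sequentially. N * (a (i k) / L + b (j k) / M) / real k \<le> c k / real k"
      using eventually_ge_at_top[of 1]
    proof eventually_elim
      case (elim k)
      have "N * (a (i k) / L + b (j k) / M) \<le> g (L * (a (i k) / L)) (M * (b (j k) / M))"
        using pos nonneg by (intro tangent) auto
      then show ?case
        using pos c[OF elim] by (intro divide_right_mono) auto
    qed
    show "\<forall>\<^sub>F k in sequentially. c k / real k \<le> g (a (i' k) / real k) (b (j' k) / real k)"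
      using eventually_ge_at_top[of 1]
    proof eventually_elim
      case (elim k)
      have "g (a (i' k) / real k) (b (j' k) / real k) = g (a (i' k)) (b (j' k)) / real k"
        using homogeneous[of "1 / real k" "a (i' k)" "b (j' k)"] elim nonneg by simp
      then show ?case
        using optimal[OF elim j'(2) i'(1) j'(1)] elim by (intro ord_le_eq_trans[OF divide_right_mono]) auto
    qed
  qed
qed

text \<open>
  This treats the degenerate case: when one of the two factors has asymptotic capacity 0, the k-th
  optimal value is at most a capacity of that factor of index at most k + d, and hence o(k).
\<close>

lemma optimal_split_limit_0:
  fixes a c :: "nat \<Rightarrow> real"
  assumes a: "(\<lambda>k. a k / real k) \<longlonglongrightarrow> 0"
    and c: "\<And>k. 1 \<le> k \<Longrightarrow> 0 \<le> c k" "\<And>k. 1 \<le> k \<Longrightarrow> \<exists>i. i \<le> k + d \<and> c k \<le> a i"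
  shows "(\<lambda>k. c k / real k) \<longlonglongrightarrow> 0"
proof -
  obtain i where i: "\<And>k. 1 \<le> k \<Longrightarrow> i k \<le> k + d" "\<And>k. 1 \<le> k \<Longrightarrow> c k \<le> a (i k)"
    using c(2) by metis
  show ?thesis
  proof (rule tendsto_sandwich[OF _ _ tendsto_const sublinear_reindex[OF a i(1)]])
    show "\<forall>\<^sub>F k in sequentially. 0 \<le> c k / real k"
      using eventually_ge_at_top[of 1] by eventually_elim (simp add: c)
    show "\<forall>\<^sub>F k in sequentially. c k / real k \<le> a (i k) / real k"
      using eventually_ge_at_top[of 1] by eventually_elim (simp add: i divide_right_mono)
  qed simp_all
qed


section \<open>The bracket on real numbers and Radon's inequality\<close>

text \<open>
  This is convexity of the power function, applied to the points X / A and Y / B with the weights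
  A / (A + B) and B / (A + B), and multiplied by A + B. It is stated in terms of A and B rather
  than of weights with sum 1 since these become the powers L^(-p/2) and M^(-p/2).
\<close>

lemma radon_inequality:
  fixes s :: real
  assumes s: "1 \<le> s \<or> s \<le> 0" and pos: "0 < A" "0 < B" "0 < X" "0 < Y"
  shows "(A + B) powr (1 - s) * (X + Y) powr s \<le> A powr (1 - s) * X powr s + B powr (1 - s) * Y powr s"
proof -
  have "convex_on {0<..} (\<lambda>x::real. x powr s)"
  proof (rule f''_ge0_imp_convex)
    fix x :: real assume "x \<in> {0<..}"
    then show "((\<lambda>x. x powr s) has_real_derivative s * x powr (s - 1)) (at x)"
      "((\<lambda>x. s * x powr (s - 1)) has_real_derivative s * ((s - 1) * x powr (s - 1 - 1))) (at x)"
      by (auto intro!: derivative_eq_intros simp del: diff_diff_eq)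
    have "0 \<le> s * (s - 1)"
      using s by (auto intro: mult_nonneg_nonneg mult_nonpos_nonpos)
    then show "0 \<le> s * ((s - 1) * x powr (s - 1 - 1))"
      by (simp only: mult.assoc[symmetric]) simp
  qed auto
  from convex_onD[OF this, of "B / (A + B)" "X / A" "Y / B"]
  have "((1 - B / (A + B)) * (X / A) + B / (A + B) * (Y / B)) powr s
      \<le> (1 - B / (A + B)) * (X / A) powr s + B / (A + B) * (Y / B) powr s"
    using pos by simp
  moreover have "1 - B / (A + B) = A / (A + B)"
    using pos by (simp add: field_simps)
  moreover have "A / (A + B) * (X / A) + B / (A + B) * (Y / B) = (X + Y) / (A + B)"
    using pos by (simp add: add_divide_distrib)
  ultimately have "((X + Y) / (A + B)) powr s
      \<le> A / (A + B) * (X / A) powr s + B / (A + B) * (Y / B) powr s"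
    by simp
  then have "(A + B) * ((X + Y) / (A + B)) powr s
      \<le> (A + B) * (A / (A + B) * (X / A) powr s + B / (A + B) * (Y / B) powr s)"
    using pos by (intro mult_left_mono) auto
  also have "\<dots> = A * (X / A) powr s + B * (Y / B) powr s"
    using pos by (simp add: distrib_left)
  finally have "(A + B) * ((X + Y) / (A + B)) powr s \<le> A * (X / A) powr s + B * (Y / B) powr s" .
  then show ?thesis
    using pos by (simp add: powr_diff powr_divide)
qed

text \<open>
  The expression that the product formula optimises, on nonnegative reals and for a finite
  parameter. For r < 2 the inner exponent is negative, and the case distinction implements
  0^s = \<infinity> and \<infinity>^(1/s) = 0, whereas \<open>0 powr s = 0\<close>. At r = 2 the maximum is
  taken, as in the first line of the formula.
\<close>

definition split_value :: "real \<Rightarrow> real \<Rightarrow> real \<Rightarrow> real" where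
  "split_value r x y =
     (if r = 2 then max x y
      else if r < 2 \<and> (x = 0 \<or> y = 0) then 0
      else (x powr (r / (r - 2)) + y powr (r / (r - 2))) powr ((r - 2) / r))"

lemma powr_exponent_inverse:
  fixes r :: real
  assumes "1 \<le> r" "r \<noteq> 2" "0 \<le> x"
  shows "(x powr (r / (r - 2))) powr ((r - 2) / r) = x"
  using assms by (cases "x = 0") (auto simp: powr_powr)

lemma bracket_eq_split_value:
  assumes "1 \<le> r" "r \<noteq> 2" "0 \<le> x" "0 \<le> y"
  shows "bracket (ereal r) (ereal x) (ereal y) = ereal (split_value r x y)"
proof (cases "r < 2")
  case True
  then have "r / (r - 2) < 0" "(r - 2) / r < 0"
    using assms by (auto simp: field_simps)
  moreover have "0 < x powr s + y powr s" if "x \<noteq> 0" "y \<noteq> 0" for s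
    using assms that by (auto intro: add_pos_pos)
  ultimately show ?thesis
    using assms True by (auto simp: bracket_def Let_def epowr_def split_value_def not_le)
next
  case False
  then have "r / (r - 2) > 0" "(r - 2) / r > 0"
    using assms by (auto simp: field_simps)
  moreover have "\<not> x powr s + y powr s \<le> 0" if "\<not> (x = 0 \<and> y = 0)" for s
    using that by (smt (verit) powr_ge_zero powr_eq_0_iff)
  ultimately show ?thesis
    using assms False
    by (cases "x = 0 \<and> y = 0") (auto simp: bracket_def Let_def epowr_def split_value_def)
qed

lemma split_value_nonneg: "0 \<le> x \<Longrightarrow> 0 \<le> y \<Longrightarrow> 0 \<le> split_value r x y"
  by (auto simp: split_value_def)

lemma split_value_0:
  assumes "2 \<le> r" "0 \<le> x"
  shows "split_value r x 0 = x" "split_value r 0 x = x"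
  using assms powr_exponent_inverse[of r x] by (auto simp: split_value_def)

lemma split_value_le:
  assumes "1 \<le> r" "r < 2" "0 \<le> x" "0 \<le> y"
  shows "split_value r x y \<le> x" "split_value r x y \<le> y"
proof -
  have *: "(x powr s + y powr s) powr ((r - 2) / r) \<le> (x powr s) powr ((r - 2) / r)"
    "(x powr s + y powr s) powr ((r - 2) / r) \<le> (y powr s) powr ((r - 2) / r)"
    if "x \<noteq> 0" "y \<noteq> 0" for s
    using assms that by (auto intro!: powr_mono2' simp: field_simps)
  show "split_value r x y \<le> x" "split_value r x y \<le> y"
    using *[of "r / (r - 2)"] assms powr_exponent_inverse[of r x] powr_exponent_inverse[of r y]
    by (auto simp: split_value_def)
qed

lemma split_value_homogeneous:
  assumes "1 \<le> r" "0 < t" "0 \<le> x" "0 \<le> y"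
  shows "split_value r (t * x) (t * y) = t * split_value r x y"
proof -
  let ?s = "r / (r - 2)"
  have "((t * x) powr ?s + (t * y) powr ?s) powr ((r - 2) / r)
      = t * (x powr ?s + y powr ?s) powr ((r - 2) / r)" if "r \<noteq> 2"
    using assms that powr_exponent_inverse[of r t]
    by (simp add: powr_mult distrib_left[symmetric])
  then show ?thesis
    using assms by (auto simp: split_value_def max_mult_distrib_left)
qed

lemma split_value_tendsto:
  assumes "1 \<le> r" "0 < x" "0 < y" and uv: "u \<longlonglongrightarrow> x" "v \<longlonglongrightarrow> y"
  shows "(\<lambda>k::nat. split_value r (u k) (v k)) \<longlonglongrightarrow> split_value r x y"
proof (cases "r = 2")
  case True
  then show ?thesis
    using tendsto_max[OF uv] by (simp add: split_value_def)
next
  case False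
  have positive: "x powr (r / (r - 2)) + y powr (r / (r - 2)) \<noteq> 0"
    using assms by (simp add: add_pos_pos less_imp_neq[symmetric])
  have "\<forall>\<^sub>F k in sequentially. u k > 0 \<and> v k > 0"
    using order_tendstoD(1)[OF uv(1) assms(2)] order_tendstoD(1)[OF uv(2) assms(3)]
    by eventually_elim simp
  then have "\<forall>\<^sub>F k in sequentially.
      (u k powr (r / (r - 2)) + v k powr (r / (r - 2))) powr ((r - 2) / r) = split_value r (u k) (v k)"
    by eventually_elim (use False in \<open>auto simp: split_value_def\<close>)
  moreover have "(\<lambda>k. (u k powr (r / (r - 2)) + v k powr (r / (r - 2))) powr ((r - 2) / r))
      \<longlonglongrightarrow> (x powr (r / (r - 2)) + y powr (r / (r - 2))) powr ((r - 2) / r)"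
    using assms positive by (intro tendsto_intros uv) auto
  ultimately show ?thesis
    using assms False by (simp add: split_value_def Lim_transform_eventually)
qed

lemma exponent_identities:
  fixes r :: real
  assumes "1 \<le> r" "r \<noteq> 2"
  shows "- (2 / r) * (r / (r - 2)) = 1 - r / (r - 2)"
    and "(1 - r / (r - 2)) * ((r - 2) / r) = - (2 / r)"
    and "r / (r - 2) * ((r - 2) / r) = 1"
  using assms by (simp_all add: field_simps)

text \<open>
  Radon's inequality applies to the bracket because L = A^(-2/r) satisfies L^s = A^(1-s).
\<close>

lemma split_value_weighted:
  assumes r: "1 \<le> r" "r \<noteq> 2" and pos: "0 < A" "0 < B" "0 < X" "0 < Y"
  defines "s \<equiv> r / (r - 2)"
  shows "split_value r (A powr (- (2 / r)) * X) (B powr (- (2 / r)) * Y)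
           = (A powr (1 - s) * X powr s + B powr (1 - s) * Y powr s) powr ((r - 2) / r)"
proof -
  have "(C powr (- (2 / r)) * Z) powr s = C powr (1 - s) * Z powr s" if "0 < C" "0 < Z" for C Z :: real
    using that exponent_identities(1)[OF r] by (simp only: powr_mult powr_powr s_def)
  then show ?thesis
    using assms by (simp add: split_value_def)
qed

text \<open>
  The equality case X = A, Y = B of Radon's inequality: the point where the linear bounds touch.
\<close>

lemma split_value_contact:
  assumes r: "1 \<le> r" and pos: "0 < A" "0 < B"
  shows "split_value r (A powr (- (2 / r)) * A) (B powr (- (2 / r)) * B) = (A + B) powr (- (2 / r)) * (A + B)"
proof (cases "r = 2")
  case True
  then show ?thesis using pos by (simp add: split_value_def powr_minus)
next
  case False
  have "C powr (1 - s) * C powr s = C" if "0 < C" for C s :: real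
    using that by (simp add: powr_add[symmetric])
  moreover have "(A + B) powr ((r - 2) / r) = (A + B) powr (- (2 / r)) * (A + B)"
  proof -
    have "(r - 2) / r = - (2 / r) + 1" using r by (simp add: field_simps)
    then show ?thesis using pos by (simp only: powr_add) simp
  qed
  ultimately show ?thesis
    using split_value_weighted[OF r False pos pos] pos by simp
qed

text \<open>
  For r > 2 and positive X, Y this is the 1/s-th power of Radon's inequality. Radon's inequality
  concerns positive arguments, so the two axes are treated separately.
\<close>

lemma split_value_tangent_ge:
  assumes r: "2 \<le> r" and pos: "0 < A" "0 < B" "0 \<le> X" "0 \<le> Y"
  shows "(A + B) powr (- (2 / r)) * (X + Y)
           \<le> split_value r (A powr (- (2 / r)) * X) (B powr (- (2 / r)) * Y)"
proof (cases "r = 2")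
  case True
  have "X + Y \<le> max (X / A) (Y / B) * A + max (X / A) (Y / B) * B"
    using pos mult_right_mono[of "X / A" "max (X / A) (Y / B)" A]
      mult_right_mono[of "Y / B" "max (X / A) (Y / B)" B] by (intro add_mono) auto
  then have "(X + Y) / (A + B) \<le> max (X / A) (Y / B)"
    using pos by (simp add: field_simps)
  then show ?thesis
    using True pos by (simp add: split_value_def powr_minus divide_inverse mult.commute)
next
  case False
  with r have r': "2 < r" "1 \<le> r" by auto
  show ?thesis
  proof (cases "X = 0 \<or> Y = 0")
    case True
    have "(A + B) powr (- (2 / r)) \<le> A powr (- (2 / r))" "(A + B) powr (- (2 / r)) \<le> B powr (- (2 / r))"
      using r' pos by (auto intro!: powr_mono2')
    with True show ?thesis
      using r pos by (auto simp: split_value_0 intro!: mult_right_mono)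
  next
    case False
    with pos have XY: "0 < X" "0 < Y" by auto
    let ?s = "r / (r - 2)"
    have "1 \<le> ?s" "0 \<le> (r - 2) / r" using r' by auto
    have "((A + B) powr (1 - ?s) * (X + Y) powr ?s) powr ((r - 2) / r)
      \<le> (A powr (1 - ?s) * X powr ?s + B powr (1 - ?s) * Y powr ?s) powr ((r - 2) / r)"
      using \<open>1 \<le> ?s\<close> \<open>0 \<le> (r - 2) / r\<close> pos XY
      by (intro powr_mono2 radon_inequality) (auto simp: zero_le_mult_iff)
    moreover have "((A + B) powr (1 - ?s) * (X + Y) powr ?s) powr ((r - 2) / r)
        = (A + B) powr (- (2 / r)) * (X + Y)"
      using exponent_identities[OF r'(2) \<open>r \<noteq> 2\<close>] XY
      by (simp only: powr_mult powr_powr) simp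
    ultimately show ?thesis
      using split_value_weighted[OF r'(2) \<open>r \<noteq> 2\<close> pos(1,2) XY] by simp
  qed
qed

text \<open>
  The exponent 1/s is negative here, so taking the 1/s-th power reverses Radon's inequality.
\<close>

lemma split_value_tangent_le:
  assumes r: "1 \<le> r" "r < 2" and pos: "0 < A" "0 < B" "0 \<le> X" "0 \<le> Y"
  shows "split_value r (A powr (- (2 / r)) * X) (B powr (- (2 / r)) * Y)
           \<le> (A + B) powr (- (2 / r)) * (X + Y)"
proof (cases "X = 0 \<or> Y = 0")
  case True
  then show ?thesis using r pos by (auto simp: split_value_def)
next
  case False
  with pos r have XY: "0 < X" "0 < Y" "r \<noteq> 2" by auto
  let ?s = "r / (r - 2)"
  have "?s \<le> 0" "(r - 2) / r \<le> 0" using r by (auto simp: divide_le_0_iff)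
  have "(A powr (1 - ?s) * X powr ?s + B powr (1 - ?s) * Y powr ?s) powr ((r - 2) / r)
    \<le> ((A + B) powr (1 - ?s) * (X + Y) powr ?s) powr ((r - 2) / r)"
    using \<open>?s \<le> 0\<close> \<open>(r - 2) / r \<le> 0\<close> pos XY
    by (intro powr_mono2' radon_inequality) (auto simp: zero_less_mult_iff)
  moreover have "((A + B) powr (1 - ?s) * (X + Y) powr ?s) powr ((r - 2) / r)
      = (A + B) powr (- (2 / r)) * (X + Y)"
    using exponent_identities[OF r(1) XY(3)] XY
    by (simp only: powr_mult powr_powr) simp
  ultimately show ?thesis
    using split_value_weighted[OF r(1) XY(3) pos(1,2) XY(1,2)] by simp
qed


section \<open>Products of star-shaped domains\<close>

text \<open>
  The set is the image of the compact space [0, 1] x K x T under a continuous map. With general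
  scaling functions this covers the p-products for finite p and, with constant functions, for
  p = \<infinity>.
\<close>

lemma compactin_scaled_products:
  assumes \<phi>: "continuous_on {0..1} \<phi>" and \<psi>: "continuous_on {0..1} \<psi>"
    and K: "compactin (Euclidean_space (2 * a)) K" and T: "compactin (Euclidean_space (2 * b)) T"
  shows "compactin (Euclidean_space (2 * (a + b)))
           (\<Union>t\<in>{0..1::real}. {append_point (2 * a) (\<lambda>i. \<phi> t * x i) (\<lambda>i. \<psi> t * y i) | x y. x \<in> K \<and> y \<in> T})"
proof -
  let ?Z = "prod_topology (top_of_set {0..1::real})
              (prod_topology (Euclidean_space (2 * a)) (Euclidean_space (2 * b)))"
  let ?f = "\<lambda>z. append_point (2 * a) (\<lambda>i. \<phi> (fst z) * fst (snd z) i) (\<lambda>i. \<psi> (fst z) * snd (snd z) i)"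
  have coordinate: "continuous_map (Euclidean_space m) euclideanreal (\<lambda>x. x i)" for m i
    unfolding Euclidean_space_def
    by (intro continuous_map_from_subtopology continuous_map_product_projection) simp
  have scale: "continuous_map ?Z euclideanreal (\<lambda>z. f (fst z))" if "continuous_on {0..1} f" for f
    using continuous_map_compose[OF continuous_map_fst, of "top_of_set {0..1}" euclideanreal f
        "prod_topology (Euclidean_space (2 * a)) (Euclidean_space (2 * b))"] that
    by (simp add: o_def)
  have left: "continuous_map ?Z euclideanreal (\<lambda>z. fst (snd z) i)" for i
    using continuous_map_compose[OF continuous_map_compose[OF continuous_map_snd continuous_map_fst] coordinate]
    by (simp add: o_def)
  have right: "continuous_map ?Z euclideanreal (\<lambda>z. snd (snd z) i)" for i
    using continuous_map_compose[OF continuous_map_compose[OF continuous_map_snd continuous_map_snd] coordinate]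
    by (simp add: o_def)
  have "continuous_map ?Z euclideanreal (\<lambda>z. ?f z k)" for k
  proof (cases "k < 2 * a")
    case True
    then show ?thesis
      using continuous_map_real_mult[OF scale[OF \<phi>] left] by (simp add: append_point_def)
  next
    case False
    then show ?thesis
      using continuous_map_real_mult[OF scale[OF \<psi>] right] by (simp add: append_point_def)
  qed
  then have "continuous_map ?Z (Euclidean_space (2 * (a + b))) ?f"
    unfolding Euclidean_space_def[of "2 * (a + b)"] continuous_map_in_subtopology
      continuous_map_componentwise_UNIV
    by (auto simp: append_point_def topspace_Euclidean_space)
  moreover have "compactin ?Z ({0..1} \<times> (K \<times> T))"
    using K T by (simp add: compactin_Times compactin_subtopology)
  ultimately have "compactin (Euclidean_space (2 * (a + b))) (?f ` ({0..1} \<times> (K \<times> T)))"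
    by (intro image_compactin)
  moreover have "?f ` ({0..1} \<times> (K \<times> T))
    = (\<Union>t\<in>{0..1}. {append_point (2 * a) (\<lambda>i. \<phi> t * x i) (\<lambda>i. \<psi> t * y i) | x y. x \<in> K \<and> y \<in> T})"
    by force
  ultimately show ?thesis by simp
qed

lemma star_shaped_scaled_products:
  assumes \<phi>: "continuous_on {0..1} \<phi>" and \<psi>: "continuous_on {0..1} \<psi>"
    and K: "star_shaped_domain a K" and T: "star_shaped_domain b T"
  shows "star_shaped_domain (a + b)
           (\<Union>t\<in>{0..1::real}. {append_point (2 * a) (\<lambda>i. \<phi> t * x i) (\<lambda>i. \<psi> t * y i) | x y. x \<in> K \<and> y \<in> T})"
    (is "star_shaped_domain _ ?P")
  unfolding star_shaped_domain_def
proof (intro conjI ballI)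
  show "compactin (Euclidean_space (2 * (a + b))) ?P"
    using K T by (intro compactin_scaled_products \<phi> \<psi>) (auto simp: star_shaped_domain_def)
  have "(\<lambda>_. 0) = append_point (2 * a) (\<lambda>i. \<phi> 0 * 0) (\<lambda>i. \<psi> 0 * 0)"
    by (simp add: append_point_def)
  moreover have "(\<lambda>_. 0) \<in> K" "(\<lambda>_. 0) \<in> T"
    using K T by (auto simp: star_shaped_domain_def)
  ultimately show "(\<lambda>_. 0) \<in> ?P"
    by (intro UN_I[of 0]) force+
next
  fix z and s :: real assume "z \<in> ?P" and s: "s \<in> {0..1}"
  then obtain t x y where t: "t \<in> {0..1}" and xy: "x \<in> K" "y \<in> T"
    and z: "z = append_point (2 * a) (\<lambda>i. \<phi> t * x i) (\<lambda>i. \<psi> t * y i)"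
    by auto
  have "(\<lambda>i. s * z i) = append_point (2 * a) (\<lambda>i. \<phi> t * (s * x i)) (\<lambda>i. \<psi> t * (s * y i))"
    by (auto simp: z append_point_def)
  moreover have "(\<lambda>i. s * x i) \<in> K" "(\<lambda>i. s * y i) \<in> T"
    using K T xy s by (auto simp: star_shaped_domain_def)
  ultimately show "(\<lambda>i. s * z i) \<in> ?P"
    using t by (intro UN_I[of t]) force+
qed

lemma star_shaped_p_product:
  assumes q: "1 \<le> q" and K: "star_shaped_domain a K" and T: "star_shaped_domain b T"
  shows "star_shaped_domain (a + b) (p_product q a K T)"
proof (cases "q = \<infinity>")
  case True
  then show ?thesis
    using star_shaped_scaled_products[of "\<lambda>_. 1" "\<lambda>_. 1", OF _ _ K T]
    by (simp add: p_product_def)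
next
  case False
  with q have "0 < 1 / real_of_ereal q"
    by (cases q) auto
  then have "continuous_on {0..1} (\<lambda>t::real. (1 - t) powr (1 / real_of_ereal q))"
    "continuous_on {0..1} (\<lambda>t::real. t powr (1 / real_of_ereal q))"
    by (auto intro!: continuous_on_powr' continuous_on_diff continuous_on_const continuous_on_id)
  from star_shaped_scaled_products[OF this K T] False show ?thesis
    by (simp add: p_product_def)
qed

lemma convex_domain_imp_star_shaped:
  assumes "convex_domain n K" "(\<lambda>_. 0) \<in> K"
  shows "star_shaped_domain n K"
  using assms unfolding convex_domain_def star_shaped_domain_def by fastforce


section \<open>Capacities as real sequences\<close>

definition product_formula ::
  "ereal \<Rightarrow> nat \<Rightarrow> (nat \<Rightarrow> real) set \<Rightarrow> nat \<Rightarrow> (nat \<Rightarrow> real) set \<Rightarrow> bool" where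
  "product_formula q n1 X1 n2 X2 \<longleftrightarrow> (\<forall>k\<ge>1.
       (2 \<le> q \<longrightarrow> c_EH (n1 + n2) k (p_product q n1 X1 X2) =
          (MIN (i, j)\<in>{(i, j). i + j = k}.
             if q = 2 then max (c_EH n1 i X1) (c_EH n2 j X2)
             else bracket q (c_EH n1 i X1) (c_EH n2 j X2))) \<and>
       (q \<le> 2 \<longrightarrow> c_EH (n1 + n2) k (p_product q n1 X1 X2) =
          (MAX (i, j)\<in>{(i, j). i + j = k + 1 \<and> i \<noteq> 0 \<and> j \<noteq> 0}.
             if q = 2 then min (c_EH n1 i X1) (c_EH n2 j X2)
             else bracket q (c_EH n1 i X1) (c_EH n2 j X2))))"

lemma c_EH_mono:
  assumes "1 \<le> k" "k \<le> l"
  shows "c_EH n k B \<le> c_EH n l B"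
proof -
  have "enat k \<le> ind n \<xi>" if "enat l \<le> ind n \<xi>" for \<xi>
    using assms(2) that by (meson enat_ord_simps(1) order_trans)
  then have "minimax n k H \<le> minimax n l H" for H
    unfolding minimax_def by (intro Inf_superset_mono) blast
  then show ?thesis
    using assms by (auto simp: c_EH_def intro!: INF_mono)
qed

text \<open>
  At p = 2 the product formula has a minimum and a maximum form. For k = 1 the minimum runs over the
  splittings 0 + 1 and 1 + 0, the maximum over 1 + 1 only. For two copies of the same domain, with first
  capacity c, they give max 0 c and c. Monotonicity extends the sign to all k.
\<close>

lemma c_EH_nonneg:
  assumes "product_formula 2 n X n X"
  shows "0 \<le> c_EH n k X"
proof -
  have "{(i, j). i + j = (1::nat)} = {(0, 1), (1, 0)}"
    by auto
  moreover have "{(i, j). i + j = (1::nat) + 1 \<and> i \<noteq> 0 \<and> j \<noteq> 0} = {(1, 1)}"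
    by auto
  moreover have "(MIN (i, j)\<in>{(i, j). i + j = 1}. max (c_EH n i X) (c_EH n j X))
      = (MAX (i, j)\<in>{(i, j). i + j = 1 + 1 \<and> i \<noteq> 0 \<and> j \<noteq> 0}. min (c_EH n i X) (c_EH n j X))"
    using assms[unfolded product_formula_def, THEN spec, of 1]
    by (simp only: order_refl simp_thms if_True) (elim conjE, erule trans[OF sym])
  ultimately have "min (max (c_EH n 0 X) (c_EH n 1 X)) (max (c_EH n 1 X) (c_EH n 0 X)) = c_EH n 1 X"
    by (simp only:) simp
  then have "max 0 (c_EH n 1 X) = c_EH n 1 X"
    by (simp add: c_EH_def max.commute)
  then have "0 \<le> c_EH n 1 X" by (metis max.cobounded1)
  then show ?thesis
    using c_EH_mono[of 1 k n X] by (cases "k = 0") (auto simp: c_EH_def)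
qed

text \<open>
  An infinite capacity would, by monotonicity, make all later ones infinite and contradict the
  existence of a real limit.
\<close>

lemma c_EH_real_sequence:
  assumes nonneg: "\<And>k. 0 \<le> c_EH n k X" and lim: "c_infinity_exists n X"
  obtains a L where "\<And>k. c_EH n k X = ereal (a k)" "\<And>k. 0 \<le> a k" "a 0 = 0"
    "(\<lambda>k. a k / real k) \<longlonglongrightarrow> L" "0 \<le> L" "c_infinity n X = ereal L"
proof -
  obtain L :: real where L: "(\<lambda>k. c_EH n k X / ereal (real k)) \<longlonglongrightarrow> ereal L"
    using lim by (auto simp: c_infinity_exists_def)
  have "c_EH n k X \<noteq> \<infinity>" for k
  proof
    assume inf: "c_EH n k X = \<infinity>"
    have "\<forall>\<^sub>F l in sequentially. c_EH n l X / ereal (real l) < ereal (L + 1)"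
      using order_tendstoD(2)[OF L] by simp
    then have "\<forall>\<^sub>F l in sequentially. False"
      using eventually_ge_at_top[of "max 1 k"]
    proof eventually_elim
      case (elim l)
      have "1 \<le> k" using inf by (cases k) (auto simp: c_EH_def)
      then have "c_EH n l X = \<infinity>"
        using c_EH_mono[of k l n X] inf elim by simp
      then show False using elim by simp
    qed
    then show False by simp
  qed
  then have real: "c_EH n k X = ereal (real_of_ereal (c_EH n k X))" for k
    using nonneg[of k] by (cases "c_EH n k X") auto
  define a where "a k = real_of_ereal (c_EH n k X)" for k
  have a: "c_EH n k X = ereal (a k)" for k
    using real a_def by simp
  have a0: "0 \<le> a k" for k
    using nonneg[of k] by (simp add: a)
  have "\<forall>\<^sub>F k in sequentially. c_EH n k X / ereal (real k) = ereal (a k / real k)"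
    using eventually_gt_at_top[of 0] by eventually_elim (simp add: a)
  with L have "(\<lambda>k. ereal (a k / real k)) \<longlonglongrightarrow> ereal L"
    by (rule Lim_transform_eventually)
  then have aL: "(\<lambda>k. a k / real k) \<longlonglongrightarrow> L" by simp
  have "0 \<le> L"
    by (rule LIMSEQ_le_const[OF aL]) (simp add: a0)
  moreover have "c_infinity n X = ereal L"
    unfolding c_infinity_def using L by (rule limI)
  moreover have "a 0 = 0" by (simp add: a_def c_EH_def)
  ultimately show ?thesis using that a a0 aL by blast
qed

lemma c_infinity_eqI:
  assumes c: "\<And>k. 1 \<le> k \<Longrightarrow> c_EH n k X = ereal (c k)" and lim: "(\<lambda>k. c k / real k) \<longlonglongrightarrow> L"
  shows "c_infinity_exists n X \<and> c_infinity n X = ereal L"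
proof -
  have "(\<lambda>k. ereal (c k / real k)) \<longlonglongrightarrow> ereal L"
    using lim by simp
  moreover have "\<forall>\<^sub>F k in sequentially. ereal (c k / real k) = c_EH n k X / ereal (real k)"
    using eventually_ge_at_top[of 1] by eventually_elim (simp add: c)
  ultimately have "(\<lambda>k. c_EH n k X / ereal (real k)) \<longlonglongrightarrow> ereal L"
    by (rule Lim_transform_eventually)
  then show ?thesis
    unfolding c_infinity_exists_def c_infinity_def by (auto intro: limI)
qed

lemma finite_splittings: "finite {(i, j). i + j = (k::nat) \<and> P i j}"
  by (rule finite_subset[of _ "{..k} \<times> {..k}"]) auto

lemma product_formula_min:
  assumes formula: "product_formula q n1 X1 n2 X2" and q: "2 \<le> q"
    and a: "\<And>k. c_EH n1 k X1 = ereal (a k)" "\<And>k. 0 \<le> a k"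
    and b: "\<And>k. c_EH n2 k X2 = ereal (b k)" "\<And>k. 0 \<le> b k"
    and g: "\<And>x y. 0 \<le> x \<Longrightarrow> 0 \<le> y \<Longrightarrow>
      (if q = 2 then max (ereal x) (ereal y) else bracket q (ereal x) (ereal y)) = ereal (g x y)"
  shows "\<exists>c. \<forall>k\<ge>1. c_EH (n1 + n2) k (p_product q n1 X1 X2) = ereal (c k) \<and>
           (\<exists>i j. i + j = k \<and> c k = g (a i) (b j)) \<and>
           (\<forall>i j. i + j = k \<longrightarrow> c k \<le> g (a i) (b j))"
proof -
  have "\<exists>c. c_EH (n1 + n2) k (p_product q n1 X1 X2) = ereal c \<and>
          (\<exists>i j. i + j = k \<and> c = g (a i) (b j)) \<and>
          (\<forall>i j. i + j = k \<longrightarrow> c \<le> g (a i) (b j))" if "1 \<le> k" for k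
  proof -
    let ?S = "(\<lambda>(i, j). ereal (g (a i) (b j))) ` {(i, j). i + j = k}"
    have "(0, k) \<in> {(i, j). i + j = k}" by simp
    then have S: "finite ?S" "?S \<noteq> {}"
      using finite_splittings[of k "\<lambda>_ _. True"] by (simp, blast)
    have "(if q = 2 then max (c_EH n1 i X1) (c_EH n2 j X2) else bracket q (c_EH n1 i X1) (c_EH n2 j X2))
        = ereal (g (a i) (b j))" for i j
      unfolding a(1) b(1) by (rule g[OF a(2) b(2)])
    then have "c_EH (n1 + n2) k (p_product q n1 X1 X2) = Min ?S"
      using formula[unfolded product_formula_def, THEN spec, of k] q that by presburger
    moreover obtain i j where "i + j = k" "Min ?S = ereal (g (a i) (b j))"
      using Min_in[OF S] by auto
    moreover have "Min ?S \<le> ereal (g (a i) (b j))" if "i + j = k" for i j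
      using S(1) that by (intro Min_le) auto
    ultimately show ?thesis by (intro exI[of _ "g (a i) (b j)"]) auto
  qed
  then show ?thesis by metis
qed

lemma product_formula_max:
  assumes formula: "product_formula q n1 X1 n2 X2" and q: "q < 2"
    and a: "\<And>k. c_EH n1 k X1 = ereal (a k)" "\<And>k. 0 \<le> a k"
    and b: "\<And>k. c_EH n2 k X2 = ereal (b k)" "\<And>k. 0 \<le> b k"
    and g: "\<And>x y. 0 \<le> x \<Longrightarrow> 0 \<le> y \<Longrightarrow> bracket q (ereal x) (ereal y) = ereal (g x y)"
  shows "\<exists>c. \<forall>k\<ge>1. c_EH (n1 + n2) k (p_product q n1 X1 X2) = ereal (c k) \<and>
           (\<exists>i j. i + j = k + 1 \<and> c k = g (a i) (b j)) \<and>
           (\<forall>i j. i + j = k + 1 \<longrightarrow> 1 \<le> i \<longrightarrow> 1 \<le> j \<longrightarrow> g (a i) (b j) \<le> c k)"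
proof -
  have "\<exists>c. c_EH (n1 + n2) k (p_product q n1 X1 X2) = ereal c \<and>
          (\<exists>i j. i + j = k + 1 \<and> c = g (a i) (b j)) \<and>
          (\<forall>i j. i + j = k + 1 \<longrightarrow> 1 \<le> i \<longrightarrow> 1 \<le> j \<longrightarrow> g (a i) (b j) \<le> c)" if "1 \<le> k" for k
  proof -
    let ?S = "(\<lambda>(i, j). ereal (g (a i) (b j))) ` {(i, j). i + j = k + 1 \<and> i \<noteq> 0 \<and> j \<noteq> 0}"
    have "(1, k) \<in> {(i, j). i + j = k + 1 \<and> i \<noteq> 0 \<and> j \<noteq> 0}"
      using that by simp
    then have S: "finite ?S" "?S \<noteq> {}"
      using finite_splittings[of "k + 1" "\<lambda>i j. i \<noteq> 0 \<and> j \<noteq> 0"] by (simp, blast)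
    have "q \<noteq> 2" "q \<le> 2" using q by auto
    then have "c_EH (n1 + n2) k (p_product q n1 X1 X2) = Max ?S"
      using formula that g a b by (simp add: product_formula_def)
    moreover obtain i j where "i + j = k + 1" "Max ?S = ereal (g (a i) (b j))"
      using Max_in[OF S] by auto
    moreover have "ereal (g (a i) (b j)) \<le> Max ?S" if "i + j = k + 1" "1 \<le> i" "1 \<le> j" for i j
      using S(1) that by (intro Max_ge) auto
    ultimately show ?thesis by (intro exI[of _ "g (a i) (b j)"]) auto
  qed
  then show ?thesis by metis
qed


section \<open>The asymptotic capacity of a product\<close>

definition product_limit :: "real \<Rightarrow> real \<Rightarrow> real \<Rightarrow> real" where
  "product_limit r L M =
     (if L = 0 \<or> M = 0 then 0 else (L powr (- (r / 2)) + M powr (- (r / 2))) powr (- (2 / r)))"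

text \<open>
  The sign \<open>\<sigma>\<close> turns the maximum for r < 2 into a minimum, so that both ranges of r are instances
  of \<open>optimal_split_limit\<close>.
\<close>

lemma optimal_split_value_limit:
  assumes r: "1 \<le> r"
    and a: "(\<lambda>k. a k / real k) \<longlonglongrightarrow> L" "\<And>k. 0 \<le> a k" "0 < L"
    and b: "(\<lambda>k. b k / real k) \<longlonglongrightarrow> M" "\<And>k. 0 \<le> b k" "0 < M"
    and d: "d = (if 2 \<le> r then 0 else 1)" and \<sigma>: "\<sigma> = (if 2 \<le> r then 1 else - 1)"
    and attained: "\<And>k. 1 \<le> k \<Longrightarrow> \<exists>i j. i + j = k + d \<and> c k = split_value r (a i) (b j)"
    and optimal: "\<And>k i j. 1 \<le> k \<Longrightarrow> i + j = k + d \<Longrightarrow> d \<le> i \<Longrightarrow> d \<le> j \<Longrightarrow>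
      \<sigma> * c k \<le> \<sigma> * split_value r (a i) (b j)"
  shows "(\<lambda>k. c k / real k) \<longlonglongrightarrow> product_limit r L M"
proof -
  define A where "A = L powr (- (r / 2))"
  define B where "B = M powr (- (r / 2))"
  have pos: "0 < A" "0 < B"
    using a b by (simp_all add: A_def B_def)
  have L: "A powr (- (2 / r)) = L" and M: "B powr (- (2 / r)) = M"
    using a b r by (simp_all add: A_def B_def powr_powr)
  let ?N = "(A + B) powr (- (2 / r))"
  let ?g = "\<lambda>x y. \<sigma> * split_value r x y"
  let ?\<theta> = "A / (A + B)"
  have \<theta>': "1 - ?\<theta> = B / (A + B)"
    using pos by (simp add: field_simps)
  have contact: "split_value r (?\<theta> * L) ((1 - ?\<theta>) * M) = ?N"
  proof -
    have "split_value r (?\<theta> * L) ((1 - ?\<theta>) * M)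
        = split_value r (1 / (A + B) * (L * A)) (1 / (A + B) * (M * B))"
      unfolding \<theta>' by (simp add: mult.commute)
    also have "\<dots> = 1 / (A + B) * split_value r (L * A) (M * B)"
      using pos a b r by (intro split_value_homogeneous) auto
    also have "\<dots> = ?N"
      using split_value_contact[OF r pos] pos by (simp add: L M)
    finally show ?thesis .
  qed
  have "(\<lambda>k. \<sigma> * c k / real k) \<longlonglongrightarrow> \<sigma> * ?N"
  proof (rule optimal_split_limit[OF a(1) b(1) a(3) b(3) a(2) b(2), where g = ?g and \<theta> = ?\<theta> and d = d])
    show "?g (t * x) (t * y) = t * ?g x y" if "0 < t" "0 \<le> x" "0 \<le> y" for t x y
      using split_value_homogeneous[OF r that] by simp
    show "\<sigma> * ?N * (u + v) \<le> ?g (L * u) (M * v)" if "0 \<le> u" "0 \<le> v" for u v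
      using split_value_tangent_ge[of r A B u v] split_value_tangent_le[of r A B u v] r pos that \<sigma>
      by (simp add: L M)
    show "(\<lambda>k. ?g (u k) (v k)) \<longlonglongrightarrow> \<sigma> * ?N"
      if "u \<longlonglongrightarrow> ?\<theta> * L" "v \<longlonglongrightarrow> (1 - ?\<theta>) * M" for u v :: "nat \<Rightarrow> real"
    proof -
      have "0 < ?\<theta> * L" "0 < (1 - ?\<theta>) * M"
        unfolding \<theta>' using pos a b by auto
      from split_value_tendsto[OF r this that] show ?thesis
        unfolding contact by (intro tendsto_intros)
    qed
    show "\<exists>i j. i + j = k + d \<and> \<sigma> * c k = ?g (a i) (b j)" if "1 \<le> k" for k
      using attained[OF that] by auto
  qed (use pos d optimal in auto)
  then have "(\<lambda>k. \<sigma> * (\<sigma> * c k / real k)) \<longlonglongrightarrow> \<sigma> * (\<sigma> * ?N)"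
    by (intro tendsto_intros)
  moreover have "\<sigma> * \<sigma> = 1" by (simp add: \<sigma>)
  then have "\<sigma> * (\<sigma> * x) = x" for x by (simp add: mult.assoc[symmetric])
  moreover have "product_limit r L M = ?N"
    using a b by (simp add: product_limit_def A_def B_def)
  ultimately show ?thesis
    by simp
qed

lemma c_infinity_p_product:
  assumes formula: "product_formula q n1 X1 n2 X2" and q: "1 \<le> q"
    and X1: "\<And>k. 0 \<le> c_EH n1 k X1" "c_infinity_exists n1 X1"
    and X2: "\<And>k. 0 \<le> c_EH n2 k X2" "c_infinity_exists n2 X2"
  shows "\<exists>L M. 0 \<le> L \<and> 0 \<le> M \<and> c_infinity n1 X1 = ereal L \<and> c_infinity n2 X2 = ereal M \<and>
     c_infinity_exists (n1 + n2) (p_product q n1 X1 X2) \<and>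
     c_infinity (n1 + n2) (p_product q n1 X1 X2) =
       ereal (if q = \<infinity> then min L M else product_limit (real_of_ereal q) L M)"
proof -
  obtain a L where a: "\<And>k. c_EH n1 k X1 = ereal (a k)" "\<And>k. 0 \<le> a k" "a 0 = 0"
    and L: "(\<lambda>k. a k / real k) \<longlonglongrightarrow> L" "0 \<le> L" "c_infinity n1 X1 = ereal L"
    using c_EH_real_sequence[OF X1] by metis
  obtain b M where b: "\<And>k. c_EH n2 k X2 = ereal (b k)" "\<And>k. 0 \<le> b k" "b 0 = 0"
    and M: "(\<lambda>k. b k / real k) \<longlonglongrightarrow> M" "0 \<le> M" "c_infinity n2 X2 = ereal M"
    using c_EH_real_sequence[OF X2] by metis
  have "\<exists>c. (\<forall>k\<ge>1. c_EH (n1 + n2) k (p_product q n1 X1 X2) = ereal (c k)) \<and>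
    (\<lambda>k. c k / real k) \<longlonglongrightarrow> (if q = \<infinity> then min L M else product_limit (real_of_ereal q) L M)"
  proof (cases q)
    case PInf
    have bracket: "(if q = 2 then max (ereal x) (ereal y) else bracket q (ereal x) (ereal y))
        = ereal (x + y)"
      for x y :: real
      using PInf by (simp add: bracket_def)
    have "2 \<le> q" using PInf by simp
    obtain c where c: "\<And>k. 1 \<le> k \<Longrightarrow> c_EH (n1 + n2) k (p_product q n1 X1 X2) = ereal (c k)"
      "\<And>k. 1 \<le> k \<Longrightarrow> \<exists>i j. i + j = k \<and> c k = a i + b j"
      "\<And>k i j. 1 \<le> k \<Longrightarrow> i + j = k \<Longrightarrow> c k \<le> a i + b j"
      using product_formula_min[OF formula \<open>2 \<le> q\<close> a(1,2) b(1,2) bracket] by blast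
    have c0: "1 \<le> k \<Longrightarrow> 0 \<le> c k" for k
      using c(2)[of k] a(2) b(2) by (auto intro: add_nonneg_nonneg)
    have "(\<lambda>k. c k / real k) \<longlonglongrightarrow> min L M"
    proof (cases "L = 0 \<or> M = 0")
      case True
      have "c k \<le> a k" "c k \<le> b k" if "1 \<le> k" for k
        using c(3)[OF that, of k 0] c(3)[OF that, of 0 k] a(3) b(3) by auto
      then have "\<exists>i\<le>k + 0. c k \<le> a i" "\<exists>i\<le>k + 0. c k \<le> b i" if "1 \<le> k" for k
        using that by auto
      then have "L = 0 \<Longrightarrow> (\<lambda>k. c k / real k) \<longlonglongrightarrow> 0" "M = 0 \<Longrightarrow> (\<lambda>k. c k / real k) \<longlonglongrightarrow> 0"
        using optimal_split_limit_0[of a c 0] optimal_split_limit_0[of b c 0] L M c0 by auto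
      then show ?thesis using True L M by (auto simp: min_def)
    next
      case False
      then have "0 < L" "0 < M" using L M by auto
      \<comment> \<open>The linear function \<open>x * L + (1 - x) * M\<close> attains its minimum at an end of [0, 1].\<close>
      show ?thesis
      proof (rule optimal_split_limit[OF L(1) M(1) \<open>0 < L\<close> \<open>0 < M\<close> a(2) b(2),
            where g = "(+)" and d = 0 and \<theta> = "if L \<le> M then 1 else 0"])
        show "min L M * (u + v) \<le> L * u + M * v" if "0 \<le> u" "0 \<le> v" for u v
          using that by (simp add: distrib_left add_mono mult_right_mono)
        show "(\<lambda>k. u k + v k) \<longlonglongrightarrow> min L M"
          if "u \<longlonglongrightarrow> (if L \<le> M then 1 else 0) * L" "v \<longlonglongrightarrow> (1 - (if L \<le> M then 1 else 0)) * M"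
          for u v :: "nat \<Rightarrow> real"
          using tendsto_add[OF that] by (simp add: min_def split: if_splits)
      qed (use c in \<open>auto simp: distrib_left\<close>)
    qed
    then show ?thesis using c(1) PInf by auto
  next
    case (real r)
    with q have r: "1 \<le> r" by simp
    have q2: "q = 2 \<longleftrightarrow> r = 2" "2 \<le> q \<longleftrightarrow> 2 \<le> r" "q < 2 \<longleftrightarrow> r < 2"
      using real by simp_all
    have "\<exists>c. (\<forall>k\<ge>1. c_EH (n1 + n2) k (p_product q n1 X1 X2) = ereal (c k)) \<and>
      (\<lambda>k. c k / real k) \<longlonglongrightarrow> product_limit r L M"
    proof (cases "2 \<le> r")
      case True
      have "2 \<le> q" using True q2(2) by simp
      have bracket: "(if q = 2 then max (ereal x) (ereal y) else bracket q (ereal x) (ereal y))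
          = ereal (split_value r x y)"
        if "0 \<le> x" "0 \<le> y" for x y
        using bracket_eq_split_value[OF r _ that] q2(1) real
        by (cases "r = 2") (simp_all add: split_value_def max_def)
      obtain c where c: "\<And>k. 1 \<le> k \<Longrightarrow> c_EH (n1 + n2) k (p_product q n1 X1 X2) = ereal (c k)"
        "\<And>k. 1 \<le> k \<Longrightarrow> \<exists>i j. i + j = k \<and> c k = split_value r (a i) (b j)"
        "\<And>k i j. 1 \<le> k \<Longrightarrow> i + j = k \<Longrightarrow> c k \<le> split_value r (a i) (b j)"
        using product_formula_min[OF formula \<open>2 \<le> q\<close> a(1,2) b(1,2) bracket] by blast
      have c0: "1 \<le> k \<Longrightarrow> 0 \<le> c k" for k
        using c(2)[of k] split_value_nonneg[OF a(2) b(2)] by auto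
      have "c k \<le> a k" "c k \<le> b k" if "1 \<le> k" for k
        using c(3)[OF that, of k 0] c(3)[OF that, of 0 k] a(2,3) b(2,3) True by (auto simp: split_value_0)
      then have ends: "\<exists>i\<le>k + 0. c k \<le> a i" "\<exists>i\<le>k + 0. c k \<le> b i" if "1 \<le> k" for k
        using that by auto
      have "(\<lambda>k. c k / real k) \<longlonglongrightarrow> product_limit r L M"
      proof (cases "L = 0 \<or> M = 0")
        case zero: True
        have "L = 0 \<Longrightarrow> (\<lambda>k. c k / real k) \<longlonglongrightarrow> 0" "M = 0 \<Longrightarrow> (\<lambda>k. c k / real k) \<longlonglongrightarrow> 0"
          using optimal_split_limit_0[of a c 0] optimal_split_limit_0[of b c 0] L M c0 ends by auto
        then show ?thesis using zero by (auto simp: product_limit_def)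
      next
        case False
        then show ?thesis
          using L M a b c True by (intro optimal_split_value_limit[OF r, of a L b M 0 1]) auto
      qed
      then show ?thesis using c(1) by auto
    next
      case False
      then have "r < 2" by simp
      have "q < 2" using \<open>r < 2\<close> q2(3) by simp
      have bracket: "bracket q (ereal x) (ereal y) = ereal (split_value r x y)"
        if "0 \<le> x" "0 \<le> y" for x y
        using bracket_eq_split_value[OF r _ that] \<open>r < 2\<close> real by simp
      obtain c where c: "\<And>k. 1 \<le> k \<Longrightarrow> c_EH (n1 + n2) k (p_product q n1 X1 X2) = ereal (c k)"
        "\<And>k. 1 \<le> k \<Longrightarrow> \<exists>i j. i + j = k + 1 \<and> c k = split_value r (a i) (b j)"
        "\<And>k i j. 1 \<le> k \<Longrightarrow> i + j = k + 1 \<Longrightarrow> 1 \<le> i \<Longrightarrow> 1 \<le> j \<Longrightarrow> split_value r (a i) (b j) \<le> c k"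
        using product_formula_max[OF formula \<open>q < 2\<close> a(1,2) b(1,2) bracket] by blast
      have c0: "1 \<le> k \<Longrightarrow> 0 \<le> c k" for k
        using c(2)[of k] split_value_nonneg[OF a(2) b(2)] by auto
      have ends: "\<exists>i\<le>k + 1. c k \<le> a i" "\<exists>i\<le>k + 1. c k \<le> b i" if k: "1 \<le> k" for k
      proof -
        obtain i j where "i + j = k + 1" "c k = split_value r (a i) (b j)"
          using c(2)[OF k] by blast
        then have "i \<le> k + 1" "c k \<le> a i" "j \<le> k + 1" "c k \<le> b j"
          using split_value_le[OF r \<open>r < 2\<close> a(2) b(2)] by auto
        then show "\<exists>i\<le>k + 1. c k \<le> a i" "\<exists>i\<le>k + 1. c k \<le> b i"
          by blast+
      qed
      have "(\<lambda>k. c k / real k) \<longlonglongrightarrow> product_limit r L M"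
      proof (cases "L = 0 \<or> M = 0")
        case zero: True
        have "L = 0 \<Longrightarrow> (\<lambda>k. c k / real k) \<longlonglongrightarrow> 0" "M = 0 \<Longrightarrow> (\<lambda>k. c k / real k) \<longlonglongrightarrow> 0"
          using optimal_split_limit_0[of a c 1] optimal_split_limit_0[of b c 1] L M c0 ends by auto
        then show ?thesis using zero by (auto simp: product_limit_def)
      next
        case False
        then show ?thesis
          using L M a b c \<open>r < 2\<close> by (intro optimal_split_value_limit[OF r, of a L b M 1 "- 1"]) auto
      qed
      then show ?thesis using c(1) by auto
    qed
    then show ?thesis using real by simp
  next
    case MInf
    with q show ?thesis by simp
  qed
  then obtain c where "\<And>k. 1 \<le> k \<Longrightarrow> c_EH (n1 + n2) k (p_product q n1 X1 X2) = ereal (c k)"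
    "(\<lambda>k. c k / real k) \<longlonglongrightarrow> (if q = \<infinity> then min L M else product_limit (real_of_ereal q) L M)"
    by blast
  from c_infinity_eqI[OF this] L M show ?thesis by blast
qed


section \<open>Iterated products\<close>

lemma epowr_nonneg: "0 \<le> epowr x r"
  by (auto simp: epowr_def)

text \<open>
  In the iteration the exponent -2/p of one step is undone by the exponent -p/2 of the next. The conventions
  0^r = \<infinity> and \<infinity>^r = 0 for r < 0 are inverse to each other, so this remains true for degenerate
  factors.
\<close>

lemma epowr_epowr_inverse:
  assumes "0 \<le> x" "r < 0" "s < 0" "r * s = 1"
  shows "epowr (epowr x r) s = x"
  using assms by (cases x) (auto simp: epowr_def powr_powr)

lemma epowr_product_limit:
  assumes "0 < r" "0 \<le> L" "0 \<le> M"
  shows "epowr (epowr (ereal L) (- (r / 2)) + epowr (ereal M) (- (r / 2))) (- (2 / r))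
           = ereal (product_limit r L M)"
  using assms by (auto simp: epowr_def product_limit_def not_le add_pos_pos)

lemma sum_list_epowr_nonneg: "0 \<le> (\<Sum>K\<leftarrow>Ks. epowr (f K) r)"
  by (intro sum_list_nonneg) (auto simp: epowr_nonneg)

lemma c_infinity_p_product_list:
  assumes formula: "\<And>n1 n2 X1 X2 q. \<lbrakk>1 \<le> n1; 1 \<le> n2; star_shaped_domain n1 X1; star_shaped_domain n2 X2;
      1 \<le> q\<rbrakk> \<Longrightarrow> product_formula q n1 X1 n2 X2"
    and p: "1 \<le> p" and n: "1 \<le> n" and "Ks \<noteq> []"
    and "\<And>K. K \<in> set Ks \<Longrightarrow> star_shaped_domain n K \<and> c_infinity_exists n K"
  shows "star_shaped_domain (length Ks * n) (p_product_list p n Ks) \<and>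
         c_infinity_exists (length Ks * n) (p_product_list p n Ks) \<and>
         c_infinity (length Ks * n) (p_product_list p n Ks) =
           (if p = \<infinity> then Min (c_infinity n ` set Ks)
            else epowr (\<Sum>K\<leftarrow>Ks. epowr (c_infinity n K) (- (real_of_ereal p / 2)))
                       (- (2 / real_of_ereal p)))"
  using assms(4,5)
proof (induction Ks rule: list_nonempty_induct)
  case (single K)
  then have K: "star_shaped_domain n K" "c_infinity_exists n K" by auto
  have "0 \<le> c_EH n k K" for k
    using c_EH_nonneg formula[OF n n K(1) K(1)] by simp
  then obtain L where "0 \<le> L" "c_infinity n K = ereal L"
    using c_EH_real_sequence[OF _ K(2)] by metis
  moreover have "0 < real_of_ereal p" if "p \<noteq> \<infinity>"
    using that p by (cases p) auto
  ultimately show ?case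
    using K by (auto simp: epowr_epowr_inverse)
next
  case (cons K Ks)
  let ?P = "p_product_list p n Ks" and ?m = "length Ks * n"
  have K: "star_shaped_domain n K" "c_infinity_exists n K"
    using cons.prems by auto
  have P: "star_shaped_domain ?m ?P" "c_infinity_exists ?m ?P"
    and P_value: "c_infinity ?m ?P = (if p = \<infinity> then Min (c_infinity n ` set Ks)
            else epowr (\<Sum>K\<leftarrow>Ks. epowr (c_infinity n K) (- (real_of_ereal p / 2)))
                       (- (2 / real_of_ereal p)))"
    using cons by auto
  have m: "1 \<le> ?m"
    using n cons.hyps by (cases Ks) auto
  have product: "p_product_list p n (K # Ks) = p_product p n K ?P"
    using cons.hyps by (cases Ks) auto
  have two: "(1::ereal) \<le> 2" by simp
  have nonneg: "0 \<le> c_EH n k K" "0 \<le> c_EH ?m k ?P" for k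
    using c_EH_nonneg[OF formula[OF n n K(1) K(1) two]] c_EH_nonneg[OF formula[OF m m P(1) P(1) two]]
    by auto
  obtain L M where LM: "0 \<le> L" "0 \<le> M" "c_infinity n K = ereal L" "c_infinity ?m ?P = ereal M"
    and exists: "c_infinity_exists (n + ?m) (p_product p n K ?P)"
    and limit: "c_infinity (n + ?m) (p_product p n K ?P) =
       ereal (if p = \<infinity> then min L M else product_limit (real_of_ereal p) L M)"
    using c_infinity_p_product[OF formula[OF n m K(1) P(1) p] p nonneg(1) K(2) nonneg(2) P(2)]
    by blast
  have "ereal (if p = \<infinity> then min L M else product_limit (real_of_ereal p) L M) =
     (if p = \<infinity> then Min (c_infinity n ` set (K # Ks))
      else epowr (\<Sum>K\<leftarrow>K # Ks. epowr (c_infinity n K) (- (real_of_ereal p / 2)))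
                 (- (2 / real_of_ereal p)))"
  proof (cases "p = \<infinity>")
    case True
    then show ?thesis
      using LM P_value cons.hyps by (simp add: ereal_min)
  next
    case False
    then have r: "0 < real_of_ereal p"
      using p by (cases p) auto
    have "epowr (ereal M) (- (real_of_ereal p / 2))
        = (\<Sum>K\<leftarrow>Ks. epowr (c_infinity n K) (- (real_of_ereal p / 2)))"
      using False r P_value unfolding LM(4)
      by (simp add: epowr_epowr_inverse sum_list_epowr_nonneg)
    then show ?thesis
      using False LM epowr_product_limit[OF r LM(1,2)] by simp
  qed
  then show ?case
    using exists limit star_shaped_p_product[OF p K(1) P(1)] unfolding product by simp
qed

theorem theorem1p9:
  fixes p :: ereal and n :: nat and Ks :: "(nat \<Rightarrow> real) set list"
  assumes formula:
    "\<And>n1 n2 X1 X2 q k.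
       \<lbrakk>1 \<le> n1; 1 \<le> n2; star_shaped_domain n1 X1; star_shaped_domain n2 X2; (1::ereal) \<le> q; 1 \<le> k\<rbrakk> \<Longrightarrow>
       (2 \<le> q \<longrightarrow> c_EH (n1 + n2) k (p_product q n1 X1 X2) =
          (MIN (i, j)\<in>{(i, j). i + j = k}.
             if q = 2 then max (c_EH n1 i X1) (c_EH n2 j X2)
             else bracket q (c_EH n1 i X1) (c_EH n2 j X2))) \<and>
       (q \<le> 2 \<longrightarrow> c_EH (n1 + n2) k (p_product q n1 X1 X2) =
          (MAX (i, j)\<in>{(i, j). i + j = k + 1 \<and> i \<noteq> 0 \<and> j \<noteq> 0}.
             if q = 2 then min (c_EH n1 i X1) (c_EH n2 j X2)
             else bracket q (c_EH n1 i X1) (c_EH n2 j X2)))"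
    and "1 \<le> p" and "1 \<le> n" and "Ks \<noteq> []"
    and "\<And>K. K \<in> set Ks \<Longrightarrow> convex_domain n K \<and> (\<lambda>_. 0) \<in> K \<and> c_infinity_exists n K"
  shows "c_infinity_exists (length Ks * n) (p_product_list p n Ks) \<and>
         c_infinity (length Ks * n) (p_product_list p n Ks) =
           (if p = \<infinity> then Min (c_infinity n ` set Ks)
            else epowr (\<Sum>K\<leftarrow>Ks. epowr (c_infinity n K) (- (real_of_ereal p / 2)))
                       (- (2 / real_of_ereal p)))"
proof -
  have product: "product_formula q n1 X1 n2 X2"
    if "1 \<le> n1" "1 \<le> n2" "star_shaped_domain n1 X1" "star_shaped_domain n2 X2" "1 \<le> q"
    for n1 n2 X1 X2 q
    unfolding product_formula_def using formula[OF that] by blast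
  have star: "star_shaped_domain n K \<and> c_infinity_exists n K" if "K \<in> set Ks" for K
    using assms(5)[OF that] convex_domain_imp_star_shaped by blast
  show ?thesis
    by (rule conjunct2[OF c_infinity_p_product_list[OF product assms(2-4) star]])
qed

end
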